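(* Every finite set of squares whose total area is at most $\frac{8}{5}$ can be packed into the unit disk (the closed disk of radius $1$). This is worst-case optimal: for every $A > \frac{8}{5}$ there exists a set of squares with total area $A$ that cannot be packed into the unit disk.
   Context: A packing of a set of squares into a container is a placement of congruent copies of the squares (translations and rotations allowed, not necessarily axis-parallel) inside the container such that the interiors of any two placed squares are disjoint. The squares in the set need not be equal. *)

theory Defs
  imports "HOL-Analysis.Analysis"
begin

definition placed_square :: "complex \<Rightarrow> real \<Rightarrow> real \<Rightarrow> complex set" where
  "placed_square c \<theta> s = {c + cis \<theta> * Complex x y | x y. \<bar>x\<bar> \<le> s / 2 \<and> \<bar>y\<bar> \<le> s / 2}"

definition packs_into :: "real list \<Rightarrow> complex set \<Rightarrow> bool" where
  "packs_into ss K \<longleftrightarrow>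
     (\<exists>c :: nat \<Rightarrow> complex. \<exists>\<theta> :: nat \<Rightarrow> real.
        (\<forall>i < length ss. placed_square (c i) (\<theta> i) (ss ! i) \<subseteq> K) \<and>
        (\<forall>i < length ss. \<forall>j < length ss. i \<noteq> j \<longrightarrow>
           interior (placed_square (c i) (\<theta> i) (ss ! i)) \<inter>
           interior (placed_square (c j) (\<theta> j) (ss ! j)) = {}))"

definition total_area :: "real list \<Rightarrow> real" where
  "total_area ss = (\<Sum>s\<leftarrow>ss. s ^ 2)"

end

theory Submission
  imports Defs "HOL-Combinatorics.List_Permutation"
begin

text \<open>All squares are placed axis-parallel, in decreasing order. Below a horizontal line they are packed
  in rows; a row is closed by the first square that does not fit, and if this square has side c and
  the row has width w and height s, then the row has area at least s^2 + c (w - s - c). Summing this over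
  the rows bounds from below the total area of a list that does not fit below the line, in terms of
  the height y of the line and the side of the largest square. For small squares the sum is compared with
  the integral of the chord length; for large ones the bound is a dynamic program over y and the
  sides of the first squares of the rows, whose solution on a grid of mesh 1/50 is tabulated and checked.

  To fill the disk, the largest square or the two largest squares s and t are put on a suitable line and
  the others below it. When s and t use up almost all of the area, they are stacked instead, and the
  rest goes into a rectangle beside them; the stack fits because the sum of the half chords at heights
  s/2 and t/2 is at least s + t whenever s^2 + t^2 is at most 8/5, with equality for s = t.
  If no side exceeds 3/10, the two half disks are filled one after the other.

  Conversely, two disjoint squares are separated by a line, so one of them lies in a half disk, which
  forces its area to be at most 4/5.\<close>

section \<open>Axis-parallel packings and rows\<close>

text \<open>The only case without slack is two squares of side sqrt (4/5), each inscribed in a half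
  disk. Nothing may be rounded there, so the stack is proved to fit exactly, and rounding the
  largest side up only narrows the rectangle left for the small squares. In all other cases the
  bounds are rounded in the safe direction: the side of a square enters by the lower end of its
  bracket where it contributes area, and by the upper end where it consumes height or chord. All
  bounds have the form "a list of area less than N fits", N being an area that every overflowing
  list must reach. The first square of the list is kept outside the summation, because its successor
  pays for what the row estimate loses; this is what makes the induction over rows close. The
  integral bound subtracts one and the same b from every chord and so weakens as b grows. The
  dynamic program avoids this by following the bracket of the first square of each row.\<close>

type_synonym spot = "real \<times> real \<times> real"

text \<open>The spot is given by its lower left corner. A negative side yields the empty set, which
  is why positivity of the sides is carried through the combination lemmas.\<close>

fun square :: "spot \<Rightarrow> complex set" where
  "square (x, y, s) = cbox (Complex x y) (Complex (x + s) (y + s))"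

fun apart :: "spot \<Rightarrow> spot \<Rightarrow> bool" where
  "apart (x, y, s) (x', y', s') \<longleftrightarrow> x + s \<le> x' \<or> x' + s' \<le> x \<or> y + s \<le> y' \<or> y' + s' \<le> y"

definition side :: "spot \<Rightarrow> real" where
  "side p = snd (snd p)"

text \<open>Comparing multisets makes the order of the list irrelevant, so the squares may be sorted
  first. Since \<open>apart\<close> is symmetric, \<open>sorted_wrt apart\<close> means pairwise
  apart.\<close>

definition packs :: "real list \<Rightarrow> complex set \<Rightarrow> bool" where
  "packs ss R \<longleftrightarrow> (\<exists>ps. mset (map side ps) = mset ss \<and> (\<forall>p\<in>set ps. square p \<subseteq> R) \<and> sorted_wrt apart ps)"

lemma side_simp [simp]: "side (x, y, s) = s"
  by (simp add: side_def)

declare square.simps [simp del]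

lemma mem_square: "z \<in> square (x, y, s) \<longleftrightarrow> x \<le> Re z \<and> Re z \<le> x + s \<and> y \<le> Im z \<and> Im z \<le> y + s"
  by (auto simp: square.simps in_cbox_complex_iff)

lemma placed_square_axis_parallel: "placed_square (Complex (x + s / 2) (y + s / 2)) 0 s = square (x, y, s)"
proof (rule set_eqI)
  fix z
  have "z \<in> placed_square (Complex (x + s / 2) (y + s / 2)) 0 s \<longleftrightarrow>
      \<bar>Re z - (x + s / 2)\<bar> \<le> s / 2 \<and> \<bar>Im z - (y + s / 2)\<bar> \<le> s / 2"
  proof
    assume "z \<in> placed_square (Complex (x + s / 2) (y + s / 2)) 0 s"
    then show "\<bar>Re z - (x + s / 2)\<bar> \<le> s / 2 \<and> \<bar>Im z - (y + s / 2)\<bar> \<le> s / 2"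
      by (auto simp: placed_square_def)
  next
    assume *: "\<bar>Re z - (x + s / 2)\<bar> \<le> s / 2 \<and> \<bar>Im z - (y + s / 2)\<bar> \<le> s / 2"
    have "z = Complex (x + s / 2) (y + s / 2) + cis 0 * Complex (Re z - (x + s / 2)) (Im z - (y + s / 2))"
      by (simp add: complex_eq_iff)
    then show "z \<in> placed_square (Complex (x + s / 2) (y + s / 2)) 0 s"
      using * unfolding placed_square_def by blast
  qed
  also have "\<dots> \<longleftrightarrow> z \<in> square (x, y, s)"
    by (simp only: mem_square) (auto simp: abs_le_iff field_simps)
  finally show "z \<in> placed_square (Complex (x + s / 2) (y + s / 2)) 0 s \<longleftrightarrow> z \<in> square (x, y, s)" .
qed

lemma apart_sym: "apart p q \<Longrightarrow> apart q p"
  by (cases p; cases q) auto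

lemma apart_interior_disjoint: "apart p q \<Longrightarrow> interior (square p) \<inter> interior (square q) = {}"
  by (cases p; cases q) (auto simp: square.simps interior_cbox in_box_complex_iff)

lemma packs_imp_packs_into:
  assumes "packs ss R"
  shows "packs_into ss R"
proof -
  obtain ps where ps: "mset (map side ps) = mset ss" "\<forall>p\<in>set ps. square p \<subseteq> R" "sorted_wrt apart ps"
    using assms unfolding packs_def by blast
  obtain f where f: "bij_betw f {..<length ss} {..<length (map side ps)}" "\<forall>i<length ss. ss ! i = map side ps ! f i"
    using permutation_Ex_bij[of ss "map side ps"] ps(1) by auto
  have fl: "f i < length ps" if "i < length ss" for i
    using f(1) that by (force simp: bij_betw_def)
  define c where "c i = (case ps ! f i of (x, y, s) \<Rightarrow> Complex (x + s / 2) (y + s / 2))" for i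
  have sq: "placed_square (c i) 0 (ss ! i) = square (ps ! f i)" if "i < length ss" for i
  proof -
    obtain x y s where p: "ps ! f i = (x, y, s)" by (cases "ps ! f i") auto
    have "ss ! i = s" using f(2) that fl[OF that] p by simp
    then show ?thesis using p placed_square_axis_parallel by (simp add: c_def)
  qed
  have ap: "apart (ps ! a) (ps ! b)" if "a < length ps" "b < length ps" "a \<noteq> b" for a b
    using ps(3) that apart_sym by (metis linorder_neqE_nat sorted_wrt_iff_nth_less)
  show ?thesis
    unfolding packs_into_def
  proof (intro exI[of _ c] exI[of _ "\<lambda>_. 0"] conjI allI impI)
    fix i assume i: "i < length ss"
    show "placed_square (c i) 0 (ss ! i) \<subseteq> R"
      using sq[OF i] ps(2) fl[OF i] by simp
    fix j assume j: "j < length ss" and ij: "i \<noteq> j"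
    have "f i \<noteq> f j" using f(1) i j ij by (auto simp: bij_betw_def inj_on_def)
    then show "interior (placed_square (c i) 0 (ss ! i)) \<inter> interior (placed_square (c j) 0 (ss ! j)) = {}"
      using sq i j apart_interior_disjoint[OF ap] fl by simp
  qed
qed

lemma packs_mset: "packs xs R \<Longrightarrow> mset xs = mset ys \<Longrightarrow> packs ys R"
  by (simp add: packs_def)

lemma packs_mono: "packs xs R \<Longrightarrow> R \<subseteq> S \<Longrightarrow> packs xs S"
  unfolding packs_def by blast

lemma packs_Nil [simp]: "packs [] R"
  unfolding packs_def by (rule exI[of _ "[]"]) auto

text \<open>The separation hypothesis is restricted to positive sides: only then does containment of
  a square in \<open>R\<close> or \<open>S\<close> constrain its coordinates.\<close>

lemma packs_appendI:
  assumes "packs xs R" "packs ys S" "R \<subseteq> T" "S \<subseteq> T" "\<forall>x\<in>set (xs @ ys). 0 < x"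
    and sep: "\<And>p q. square p \<subseteq> R \<Longrightarrow> square q \<subseteq> S \<Longrightarrow> 0 < side p \<Longrightarrow> 0 < side q \<Longrightarrow> apart p q"
  shows "packs (xs @ ys) T"
proof -
  obtain ps where ps: "mset (map side ps) = mset xs" "\<forall>p\<in>set ps. square p \<subseteq> R" "sorted_wrt apart ps"
    using assms(1) unfolding packs_def by blast
  obtain qs where qs: "mset (map side qs) = mset ys" "\<forall>p\<in>set qs. square p \<subseteq> S" "sorted_wrt apart qs"
    using assms(2) unfolding packs_def by blast
  have "0 < side p" if "p \<in> set ps" for p
    using that ps(1) assms(5) by (metis image_eqI list.set_map mset_eq_setD set_append UnI1)
  moreover have "0 < side q" if "q \<in> set qs" for q
    using that qs(1) assms(5) by (metis image_eqI list.set_map mset_eq_setD set_append UnI2)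
  ultimately have "sorted_wrt apart (ps @ qs)"
    using ps qs sep by (auto simp: sorted_wrt_append)
  moreover have "square p \<subseteq> T" if "p \<in> set (ps @ qs)" for p
    using that ps(2) qs(2) assms(3,4) by (metis Un_iff set_append subset_trans)
  moreover have "mset (map side (ps @ qs)) = mset (xs @ ys)"
    using ps(1) qs(1) by simp
  ultimately show ?thesis
    unfolding packs_def by blast
qed

lemma corners_in_square:
  assumes "0 < s"
  shows "Complex x y \<in> square (x, y, s)" "Complex (x + s) (y + s) \<in> square (x, y, s)"
  using assms by (simp_all only: mem_square) auto

lemma packs_above_below:
  assumes "packs xs R" "packs ys S" "R \<subseteq> T" "S \<subseteq> T" "\<forall>x\<in>set (xs @ ys). 0 < x"
    and "R \<subseteq> {z. c \<le> Im z}" "S \<subseteq> {z. Im z \<le> c}"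
  shows "packs (xs @ ys) T"
proof (rule packs_appendI[OF assms(1-5)])
  fix p q assume *: "square p \<subseteq> R" "square q \<subseteq> S" "0 < side p" "0 < side q"
  obtain x y s x' y' s' where pq: "p = (x, y, s)" "q = (x', y', s')" by (cases p; cases q) auto
  have "c \<le> y" using corners_in_square(1)[of s x y] * pq assms(6) by force
  moreover have "y' + s' \<le> c" using corners_in_square(2)[of s' x' y'] * pq assms(7) by force
  ultimately show "apart p q" using pq by auto
qed

lemma packs_left_right:
  assumes "packs xs R" "packs ys S" "R \<subseteq> T" "S \<subseteq> T" "\<forall>x\<in>set (xs @ ys). 0 < x"
    and "R \<subseteq> {z. Re z \<le> c}" "S \<subseteq> {z. c \<le> Re z}"
  shows "packs (xs @ ys) T"
proof (rule packs_appendI[OF assms(1-5)])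
  fix p q assume *: "square p \<subseteq> R" "square q \<subseteq> S" "0 < side p" "0 < side q"
  obtain x y s x' y' s' where pq: "p = (x, y, s)" "q = (x', y', s')" by (cases p; cases q) auto
  have "x + s \<le> c" using corners_in_square(2)[of s x y] * pq assms(6) by force
  moreover have "c \<le> x'" using corners_in_square(1)[of s' x' y'] * pq assms(7) by force
  ultimately show "apart p q" using pq by auto
qed

lemma packs_single: "square (x, y, s) \<subseteq> R \<Longrightarrow> packs [s] R"
  unfolding packs_def by (rule exI[of _ "[(x, y, s)]"]) auto

text \<open>Needed for the upper half disk and for the lower square of a stack, which are mirror
  images of cases treated directly.\<close>

lemma packs_mirror:
  assumes "packs ss R"
  shows "packs ss (cnj ` R)"
proof -
  obtain ps where ps: "mset (map side ps) = mset ss" "\<forall>p\<in>set ps. square p \<subseteq> R" "sorted_wrt apart ps"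
    using assms unfolding packs_def by blast
  \<comment> \<open>The mirrored square has its lower left corner at the image of the upper left
    one, hence \<open>- y - s\<close>.\<close>
  define m where "m = (\<lambda>(x, y, s). (x, - y - s, s) :: spot)"
  have "side (m p) = side p" for p by (cases p) (auto simp: m_def)
  then have "side \<circ> m = side" by auto
  then have "map side (map m ps) = map side ps" by (simp only: map_map)
  moreover have "square (m p) \<subseteq> cnj ` R" if "square p \<subseteq> R" for p
  proof
    fix z assume "z \<in> square (m p)"
    then have "cnj z \<in> square p" by (cases p) (auto simp: m_def mem_square)
    then show "z \<in> cnj ` R" using that by (metis complex_cnj_cnj image_eqI subsetD)
  qed
  moreover have "sorted_wrt apart (map m ps)"
    unfolding sorted_wrt_map
    by (rule sorted_wrt_mono_rel[OF _ ps(3)]) (auto simp: m_def split: prod.splits)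
  ultimately show ?thesis
    unfolding packs_def using ps by (intro exI[of _ "map m ps"]) (auto simp del: map_map)
qed

section \<open>Greedy rows of squares hanging from a line\<close>

fun row :: "real \<Rightarrow> real \<Rightarrow> real list \<Rightarrow> spot list" where
  "row x y [] = []"
| "row x y (s # ss) = (x, y - s, s) # row (x + s) y ss"

lemma map_side_row: "map side (row x y ss) = ss"
  by (induction ss arbitrary: x) auto

lemma row_right_of: "\<forall>s\<in>set ss. 0 < s \<Longrightarrow> p \<in> set (row x y ss) \<Longrightarrow> x \<le> fst p"
proof (induction ss arbitrary: x)
  case (Cons s ss)
  consider "p = (x, y - s, s)" | "p \<in> set (row (x + s) y ss)"
    using Cons.prems(2) by auto
  then show ?case
  proof cases
    case 2
    then have "x + s \<le> fst p" using Cons.prems(1) by (intro Cons.IH) auto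
    then show ?thesis using Cons.prems(1) by simp
  qed simp
qed simp

lemma sorted_row: "\<forall>s\<in>set ss. 0 < s \<Longrightarrow> sorted_wrt apart (row x y ss)"
proof (induction ss arbitrary: x)
  case (Cons s ss)
  have "apart (x, y - s, s) p" if "p \<in> set (row (x + s) y ss)" for p
    using row_right_of[OF _ that] Cons.prems by (cases p) auto
  then show ?case using Cons by auto
qed auto

lemma mem_row:
  "p \<in> set (row x y ss) \<Longrightarrow> \<exists>us t vs. ss = us @ t # vs \<and> p = (x + sum_list us, y - t, t)"
proof (induction ss arbitrary: x)
  case (Cons s ss)
  show ?case
  proof (cases "p = (x, y - s, s)")
    case True
    then show ?thesis by (intro exI[of _ "[]"] exI[of _ s] exI[of _ ss]) auto
  next
    case False
    then have "p \<in> set (row (x + s) y ss)"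
      using Cons.prems by auto
    from Cons.IH[OF this] obtain us t vs where "ss = us @ t # vs" "p = (x + s + sum_list us, y - t, t)"
      by blast
    then show ?thesis by (intro exI[of _ "s # us"] exI[of _ t] exI[of _ vs]) (auto simp: algebra_simps)
  qed
qed auto

lemma packs_row:
  assumes "\<forall>s\<in>set ss. 0 < s"
    and "\<And>us t vs. ss = us @ t # vs \<Longrightarrow> square (x + sum_list us, y - t, t) \<subseteq> R"
  shows "packs ss R"
  unfolding packs_def
proof (intro exI[of _ "row x y ss"] conjI ballI)
  show "square p \<subseteq> R" if "p \<in> set (row x y ss)" for p
    using mem_row[OF that] assms(2) by blast
qed (simp_all add: map_side_row sorted_row assms(1))

text \<open>Take the longest prefix in which every element is admissible after its predecessors.
  \<open>P us t\<close> reads: \<open>t\<close> may follow the squares \<open>us\<close> in the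
  row.\<close>

lemma greedy_prefix:
  assumes "P [] x"
  obtains ys zs where "x # xs = ys @ zs" "ys \<noteq> []"
    "\<And>us t vs. ys = us @ t # vs \<Longrightarrow> P us t" "zs = [] \<or> \<not> P ys (hd zs)"
proof -
  define Q where "Q n \<longleftrightarrow> (\<forall>us t vs. take n (x # xs) = us @ t # vs \<longrightarrow> P us t)" for n
  define N where "N = Suc (length xs)"
  define n where "n = Max {n. n \<le> N \<and> Q n}"
  have fin: "finite {n. n \<le> N \<and> Q n}" by auto
  have Q1: "Q 1" unfolding Q_def using assms by (auto simp: Cons_eq_append_conv)
  have "n \<in> {n. n \<le> N \<and> Q n}" unfolding n_def by (rule Max_in) (use fin Q1 N_def in auto)
  then have n: "n \<le> N" "Q n" by auto
  have n1: "1 \<le> n" unfolding n_def by (rule Max_ge) (use fin Q1 N_def in auto)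
  show ?thesis
  proof (rule that[of "take n (x # xs)" "drop n (x # xs)"])
    show "x # xs = take n (x # xs) @ drop n (x # xs)" by simp
    show "take n (x # xs) \<noteq> []" using n1 by auto
    show "P us t" if "take n (x # xs) = us @ t # vs" for us t vs
      using n(2) that unfolding Q_def by blast
    show "drop n (x # xs) = [] \<or> \<not> P (take n (x # xs)) (hd (drop n (x # xs)))"
    proof (rule ccontr)
      assume *: "\<not> (drop n (x # xs) = [] \<or> \<not> P (take n (x # xs)) (hd (drop n (x # xs))))"
      then have lt: "n < N" by (auto simp: N_def not_le)
      have "take (Suc n) (x # xs) = take n (x # xs) @ [hd (drop n (x # xs))]"
        by (rule take_hd_drop[symmetric]) (use lt N_def in simp)
      then have "P us t" if "take (Suc n) (x # xs) = us @ t # vs" for us t vs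
        using * n(2) that unfolding Q_def by (cases vs rule: rev_cases) auto
      then have "Q (Suc n)"
        unfolding Q_def by blast
      then have "Suc n \<le> Max {n. n \<le> N \<and> Q n}" by (intro Max_ge[OF fin]) (use lt in simp)
      then show False by (simp add: n_def)
    qed
  qed
qed

definition desc :: "real list \<Rightarrow> bool" where
  "desc xs \<longleftrightarrow> sorted_wrt (\<ge>) xs \<and> (\<forall>x\<in>set xs. 0 < x)"

lemma desc_append: "desc (xs @ ys) \<longleftrightarrow> desc xs \<and> desc ys \<and> (\<forall>x\<in>set xs. \<forall>y\<in>set ys. y \<le> x)"
  by (auto simp: desc_def sorted_wrt_append)

lemma desc_Cons: "desc (x # xs) \<longleftrightarrow> 0 < x \<and> (\<forall>y\<in>set xs. y \<le> x) \<and> desc xs"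
  by (auto simp: desc_def)

lemma desc_Nil [simp]: "desc []"
  by (simp add: desc_def)

lemma total_area_simps [simp]:
  "total_area [] = 0" "total_area (x # xs) = x\<^sup>2 + total_area xs"
  "total_area (xs @ ys) = total_area xs + total_area ys"
  by (simp_all add: total_area_def)

lemma total_area_nonneg: "0 \<le> total_area xs"
  by (induction xs) auto

lemma area_ge_width: "\<forall>x\<in>set xs. c \<le> x \<Longrightarrow> 0 \<le> c \<Longrightarrow> c * sum_list xs \<le> total_area xs"
proof (induction xs)
  case (Cons x xs)
  then have "c * x \<le> x * x" by (intro mult_right_mono) auto
  then show ?case using Cons by (simp add: algebra_simps power2_eq_square)
qed simp

text \<open>Every square of \<open>ys\<close> has side at least \<open>c\<close>, hence area at
  least \<open>c\<close> times its width, and the widths sum to more than \<open>w - s - c\<close>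
  because \<open>c\<close> did not fit. The maximum with 0 covers rows where this difference is
  negative.\<close>

lemma row_area:
  assumes "desc (s # ys @ c # zs)" "w < s + sum_list ys + c"
  shows "s\<^sup>2 + c * max 0 (w - s - c) \<le> total_area (s # ys)"
proof -
  have c: "0 < c" "\<forall>x\<in>set ys. c \<le> x" using assms(1) by (auto simp: desc_Cons desc_append)
  then have "c * sum_list ys \<le> total_area ys" by (intro area_ge_width) auto
  moreover have "c * max 0 (w - s - c) \<le> c * sum_list ys"
    using c assms(2) by (intro mult_left_mono) (auto intro!: sum_list_nonneg)
  ultimately show ?thesis by simp
qed

section \<open>Shelf packing in circular caps\<close>

text \<open>As \<open>sqrt\<close> is odd on the reals, this is negative for arguments beyond 1 in
  absolute value, so \<open>half_antimono\<close> holds without range conditions.\<close>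

definition half :: "real \<Rightarrow> real" where
  "half t = sqrt (1 - t\<^sup>2)"

text \<open>The largest horizontal distance from the axis available to a square of side
  \<open>s\<close> hanging from the line \<open>y\<close>: the shorter of the half chords at its top
  and bottom.\<close>

definition reach :: "real \<Rightarrow> real \<Rightarrow> real" where
  "reach y s = half (max \<bar>y\<bar> \<bar>y - s\<bar>)"

definition cap :: "real \<Rightarrow> complex set" where
  "cap y = cball 0 1 \<inter> {z. Im z \<le> y}"

lemma mem_disk: "z \<in> cball 0 1 \<longleftrightarrow> (Re z)\<^sup>2 + (Im z)\<^sup>2 \<le> 1"
  by (simp add: cmod_def)

lemma half_abs [simp]: "half \<bar>t\<bar> = half t"
  by (simp add: half_def)

lemma half_minus [simp]: "half (- t) = half t"
  by (simp add: half_def)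

lemma half_antimono: "\<bar>a\<bar> \<le> \<bar>b\<bar> \<Longrightarrow> half b \<le> half a"
  by (simp add: half_def abs_le_square_iff)

lemma half_nonneg: "\<bar>t\<bar> \<le> 1 \<Longrightarrow> 0 \<le> half t"
  by (simp add: half_def abs_square_le_1)

lemma half_sq: "\<bar>t\<bar> \<le> 1 \<Longrightarrow> (half t)\<^sup>2 = 1 - t\<^sup>2"
  by (simp add: half_def abs_square_le_1)

lemma reach_antimono: "0 \<le> s \<Longrightarrow> s \<le> s' \<Longrightarrow> reach y s' \<le> reach y s"
  unfolding reach_def by (rule half_antimono) auto

lemma cap_mono: "y \<le> y' \<Longrightarrow> cap y \<subseteq> cap y'"
  by (auto simp: cap_def)

lemma square_in_strip:
  assumes "- reach y s \<le> x" "x + s \<le> reach y s" "0 < s" "y \<le> 1" "- 1 \<le> y - s"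
  shows "square (x, y - s, s) \<subseteq> cball 0 1 \<inter> {z. y - s \<le> Im z \<and> Im z \<le> y}"
proof
  fix z assume z: "z \<in> square (x, y - s, s)"
  let ?m = "max \<bar>y\<bar> \<bar>y - s\<bar>"
  have m: "\<bar>Im z\<bar> \<le> ?m" "\<bar>?m\<bar> \<le> 1" using z assms by (auto simp: mem_square)
  have "\<bar>Re z\<bar> \<le> half ?m" using z assms(1,2) unfolding mem_square reach_def abs_le_iff by linarith
  then have "(Re z)\<^sup>2 \<le> (half ?m)\<^sup>2" by (rule abs_le_square_iff[THEN iffD1, OF order_trans]) simp
  moreover have "(half ?m)\<^sup>2 = 1 - ?m\<^sup>2" by (rule half_sq) (rule m(2))
  moreover have "(Im z)\<^sup>2 \<le> ?m\<^sup>2" using m by (intro abs_le_square_iff[THEN iffD1]) auto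
  ultimately have "(Re z)\<^sup>2 + (Im z)\<^sup>2 \<le> 1" by linarith
  then have "z \<in> cball 0 1" by (simp only: mem_disk)
  then show "z \<in> cball 0 1 \<inter> {z. y - s \<le> Im z \<and> Im z \<le> y}"
    using z by (auto simp: mem_square)
qed

text \<open>The row starts at \<open>- reach y s\<close>, dictated by its largest square, while a
  later square \<open>t\<close> may extend on the right to its own \<open>reach y t\<close>, which
  is at least as large. The width relevant for a misfit \<open>c\<close> is therefore
  \<open>reach y s + reach y c\<close>.\<close>

lemma disk_row:
  assumes d: "desc (s # xs)" and fit: "- 1 \<le> y - s" "y \<le> 1" "s \<le> 2 * reach y s"
  obtains ys zs where "s # xs = ys @ zs" "ys \<noteq> []"
    "packs ys (cball 0 1 \<inter> {z. y - s \<le> Im z \<and> Im z \<le> y})"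
    "zs = [] \<or> s\<^sup>2 + hd zs * max 0 (reach y s + reach y (hd zs) - s - hd zs) \<le> total_area ys"
proof -
  let ?P = "\<lambda>us t. sum_list us + t \<le> reach y s + reach y t"
  obtain ys zs where yz: "s # xs = ys @ zs" "ys \<noteq> []" "\<And>us t vs. ys = us @ t # vs \<Longrightarrow> ?P us t"
    "zs = [] \<or> \<not> ?P ys (hd zs)"
    by (rule greedy_prefix[of ?P s xs]) (use fit(3) in simp, blast)
  have dy: "desc ys" "\<forall>t\<in>set ys. t \<le> s"
  proof -
    show "desc ys" using d yz(1) by (simp add: desc_append)
    have "\<forall>t\<in>set (s # xs). t \<le> s" using d by (simp add: desc_Cons)
    then show "\<forall>t\<in>set ys. t \<le> s" unfolding yz(1) by simp
  qed
  have "packs ys (cball 0 1 \<inter> {z. y - s \<le> Im z \<and> Im z \<le> y})"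
  proof (rule packs_row[of _ "- reach y s" y])
    show "\<forall>s\<in>set ys. 0 < s" using dy by (simp add: desc_def)
    fix us t vs assume *: "ys = us @ t # vs"
    have t: "0 < t" "t \<le> s" "\<forall>u\<in>set us. 0 < u" using * dy by (auto simp: desc_def)
    have "0 \<le> sum_list us" by (rule sum_list_nonneg) (use t(3) in force)
    moreover have "reach y s \<le> reach y t" using t by (intro reach_antimono) auto
    ultimately have "square (- reach y s + sum_list us, y - t, t) \<subseteq> cball 0 1 \<inter> {z. y - t \<le> Im z \<and> Im z \<le> y}"
      using yz(3)[OF *] t fit by (intro square_in_strip) auto
    then show "square (- reach y s + sum_list us, y - t, t) \<subseteq> cball 0 1 \<inter> {z. y - s \<le> Im z \<and> Im z \<le> y}"
      using t(2) by force
  qed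
  moreover have "s\<^sup>2 + hd zs * max 0 (reach y s + reach y (hd zs) - s - hd zs) \<le> total_area ys" if ne: "zs \<noteq> []"
  proof -
    obtain ys' where ys': "ys = s # ys'" using yz(1,2) by (cases ys) auto
    obtain c zs' where zs': "zs = c # zs'" using ne by (cases zs) auto
    have "desc (s # ys' @ c # zs')" using d yz(1) ys' zs' by simp
    then show ?thesis
      using row_area[of s ys' c zs' "reach y s + reach y c"] yz(4) ys' zs' by auto
  qed
  ultimately show ?thesis using that yz(1,2) by blast
qed

text \<open>Common induction step of all cap packings: the first row is settled, and what remains is
  a shorter list below \<open>y - s\<close> whose area has dropped by at least the bound of
  \<open>row_area\<close>.\<close>

lemma packs_cap_step:
  assumes d: "desc (s # xs)" and fit: "- 1 \<le> y - s" "y \<le> 1" "s \<le> 2 * reach y s"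
    and rest: "\<And>c zs. desc (c # zs) \<Longrightarrow> c \<le> s \<Longrightarrow> length zs < length xs \<Longrightarrow>
      total_area (c # zs) \<le> total_area (s # xs) - s\<^sup>2 - c * max 0 (reach y s + reach y c - s - c) \<Longrightarrow>
      packs (c # zs) (cap (y - s))"
  shows "packs (s # xs) (cap y)"
proof -
  obtain ys zs where yz: "s # xs = ys @ zs" "ys \<noteq> []"
    "packs ys (cball 0 1 \<inter> {z. y - s \<le> Im z \<and> Im z \<le> y})"
    "zs = [] \<or> s\<^sup>2 + hd zs * max 0 (reach y s + reach y (hd zs) - s - hd zs) \<le> total_area ys"
    by (rule disk_row[OF d fit])
  have "packs zs (cap (y - s))"
  proof (cases zs)
    case (Cons c zs')
    have "total_area (s # xs) = total_area ys + total_area zs" using yz(1) total_area_simps(3) by metis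
    moreover have "desc zs" using d yz(1) desc_append by metis
    moreover have "c \<le> s" using d yz(1) Cons by (auto simp: desc_Cons Cons_eq_append_conv)
    moreover have "length zs' < length xs" using arg_cong[OF yz(1), of length] yz(2) Cons by (cases ys) auto
    ultimately show ?thesis using rest[of c zs'] yz(4) Cons by simp
  qed simp
  moreover have "\<forall>x\<in>set (ys @ zs). 0 < x" using d yz(1) by (metis desc_def)
  moreover have "0 < s" using d by (simp add: desc_Cons)
  ultimately have "packs (ys @ zs) (cap y)"
    using yz(3) by (intro packs_above_below[where c = "y - s"]) (auto simp: cap_def)
  then show ?thesis using yz(1) by simp
qed

text \<open>A lower bound for the area beyond the first row of a list of squares with sides at most b
  that does not fit: a row of width w whose successor has height h contributes at least (w - b) h.\<close>

definition Phi :: "real \<Rightarrow> real \<Rightarrow> real" where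
  "Phi b u = integral {- 1..u} (\<lambda>t. max 0 (2 * half t - b))"

lemma continuous_half: "continuous_on S half"
  unfolding half_def by (intro continuous_intros)

lemma Phi_integrable: "(\<lambda>t. max 0 (2 * half t - b)) integrable_on {p..q}"
  by (intro integrable_continuous_real continuous_intros continuous_half)

lemma Phi_mono: "u \<le> v \<Longrightarrow> Phi b u \<le> Phi b v"
  unfolding Phi_def by (intro integral_subset_le Phi_integrable) auto

lemma Phi_nonneg: "0 \<le> Phi b u"
  unfolding Phi_def by (intro integral_nonneg Phi_integrable) auto

lemma Phi_bound:
  assumes "p \<le> u" "- 1 \<le> p" "u \<le> 0"
  shows "integral {p..u} (\<lambda>t. max 0 (2 * half t - b)) \<le> (u - p) * max 0 (2 * half u - b)"
proof -
  have "integral {p..u} (\<lambda>t. max 0 (2 * half t - b)) \<le> integral {p..u} (\<lambda>t. max 0 (2 * half u - b))"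
  proof (rule integral_le)
    fix t assume "t \<in> {p..u}"
    then have "half t \<le> half u" using assms by (intro half_antimono) auto
    then show "max 0 (2 * half t - b) \<le> max 0 (2 * half u - b)" by auto
  qed (auto intro: Phi_integrable)
  then show ?thesis using assms by simp
qed

text \<open>Below the centre the chord at the top \<open>u\<close> of a strip is its longest one, so
  it bounds the integral over the strip of height \<open>h\<close>. If the strip leaves the disk,
  only the part above -1 counts.\<close>

lemma Phi_step:
  assumes "u \<le> 0" "0 \<le> h"
  shows "Phi b u \<le> Phi b (u - h) + h * max 0 (2 * half u - b)"
proof -
  consider "u < - 1" | "- 1 \<le> u" "u - h < - 1" | "- 1 \<le> u - h" by linarith
  then show ?thesis
  proof cases
    case 1 then show ?thesis using assms by (simp add: Phi_def)
  next
    case 2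
    have "Phi b u \<le> (u - (- 1)) * max 0 (2 * half u - b)"
      unfolding Phi_def by (rule Phi_bound) (use 2 assms in auto)
    also have "\<dots> \<le> h * max 0 (2 * half u - b)" by (rule mult_right_mono) (use 2 in auto)
    finally show ?thesis using Phi_nonneg[of b "u - h"] by linarith
  next
    case 3
    have "Phi b u = Phi b (u - h) + integral {u - h..u} (\<lambda>t. max 0 (2 * half t - b))"
      unfolding Phi_def
      using Henstock_Kurzweil_Integration.integral_combine[of "- 1" "u - h" u "\<lambda>t. max 0 (2 * half t - b)"] 3 assms Phi_integrable
      by simp
    moreover have "integral {u - h..u} (\<lambda>t. max 0 (2 * half t - b)) \<le> (u - (u - h)) * max 0 (2 * half u - b)"
      by (rule Phi_bound) (use 3 assms in auto)
    ultimately show ?thesis by simp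
  qed
qed

lemma Phi_eq_0:
  assumes "u < - 1 \<or> u \<le> 0 \<and> 2 * half u \<le> b"
  shows "Phi b u = 0"
proof (cases "u < - 1")
  case False
  then have "Phi b u \<le> (u - (- 1)) * max 0 (2 * half u - b)"
    unfolding Phi_def using assms by (intro Phi_bound) auto
  then show ?thesis using False assms Phi_nonneg[of b u] by simp
qed (simp add: Phi_def)

text \<open>The accounting device of the row method: a row loses the term \<open>- c\<close> to its
  misfit, but the misfit heads the next row and adds its area c^2. Together they give
  \<open>c\<close> times the width diminished by \<open>b\<close> alone.\<close>

lemma mult_le_square_plus:
  fixes c :: real
  assumes "0 \<le> c" "x - b \<le> y - s"
  shows "c * max 0 (x - b) \<le> c\<^sup>2 + c * max 0 (y - s - c)"
proof -
  have "c * max 0 (x - b) \<le> c * (c + max 0 (y - s - c))"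
    by (rule mult_left_mono) (use assms in auto)
  then show ?thesis by (simp add: algebra_simps power2_eq_square)
qed

lemma reach_neg: "y \<le> 0 \<Longrightarrow> 0 \<le> s \<Longrightarrow> reach y s = half (y - s)"
  using half_minus[of "y - s"] by (simp add: reach_def max_def)

lemma reach_pos: "0 \<le> s \<Longrightarrow> s \<le> y \<Longrightarrow> reach y s = half y"
  by (simp add: reach_def max_def)

text \<open>Induction over rows with \<open>b\<close> fixed while \<open>s\<close> decreases. Below
  the centre the chord at the bottom of a row decides its width; it is also the chord at the top of
  the next strip, of height \<open>c\<close>, so \<open>Phi_step\<close> applies exactly.\<close>

lemma packs_lower_cap:
  assumes "desc (s # xs)" "s \<le> b" "y \<le> 0" "total_area (s # xs) < s\<^sup>2 + Phi b (y - s)"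
  shows "packs (s # xs) (cap y)"
  using assms
proof (induction "length xs" arbitrary: s xs y rule: less_induct)
  case less
  have s: "0 < s" using less.prems by (simp add: desc_Cons)
  have r: "reach y s = half (y - s)" using less.prems s by (intro reach_neg) auto
  show ?case
  proof (cases "- 1 \<le> y - s \<and> s \<le> 2 * reach y s")
    case False
    \<comment> \<open>If the first square itself does not fit, the hypothesis would say that the
      total area is less than \<open>s\<^sup>2\<close>.\<close>
    then have "Phi b (y - s) = 0" using less.prems s r by (intro Phi_eq_0) auto
    then show ?thesis using less.prems total_area_nonneg[of xs] by simp
  next
    case True
    show ?thesis
    proof (rule packs_cap_step)
      show "desc (s # xs)" "- 1 \<le> y - s" "y \<le> 1" "s \<le> 2 * reach y s" using less.prems True by auto
      fix c zs
      assume c: "desc (c # zs)" "c \<le> s" and len: "length zs < length xs"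
        and ar: "total_area (c # zs) \<le> total_area (s # xs) - s\<^sup>2 - c * max 0 (reach y s + reach y c - s - c)"
      have c0: "0 < c" using c by (simp add: desc_Cons)
      have "reach y s \<le> reach y c" using c c0 by (intro reach_antimono) auto
      then have "c * max 0 (2 * half (y - s) - b) \<le> c\<^sup>2 + c * max 0 ((reach y s + reach y c) - s - c)"
        using c0 r less.prems by (intro mult_le_square_plus) auto
      moreover have "Phi b (y - s) \<le> Phi b (y - s - c) + c * max 0 (2 * half (y - s) - b)"
        using less.prems s c0 by (intro Phi_step) auto
      ultimately have "total_area (c # zs) < c\<^sup>2 + Phi b (y - s - c)"
        using ar less.prems(4) by linarith
      then show "packs (c # zs) (cap (y - s))"
        using c less.prems s by (intro less.hyps[OF len]) auto
    qed
  qed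
qed

text \<open>Between the centre and height \<open>t\<close> every chord is at least that at
  \<open>t\<close>, so rows above the centre are charged this constant width. \<open>t\<close> stays
  fixed while \<open>y\<close> descends. A row that would cross the centre is started at height 0
  instead; this costs at most a strip of height \<open>b\<close>, whence
  \<open>Phi b (- b)\<close>.\<close>

lemma packs_upper_cap:
  assumes "desc (s # xs)" "s \<le> b" "0 \<le> y" "y \<le> t" "t \<le> 1"
    and "total_area (s # xs) < s\<^sup>2 + max 0 (2 * half t - b) * (y - s) + Phi b (- b)"
  shows "packs (s # xs) (cap y)"
  using assms
proof (induction "length xs" arbitrary: s xs y rule: less_induct)
  case less
  let ?M = "max 0 (2 * half t - b)"
  have s: "0 < s" using less.prems by (simp add: desc_Cons)
  have ty: "half t \<le> half y" using less.prems by (intro half_antimono) auto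
  show ?case
  proof (cases "s \<le> y \<and> s \<le> 2 * half y")
    case False
    \<comment> \<open>Either the height \<open>y - s\<close> is negative, or the chord at
      \<open>t\<close> is shorter than \<open>s\<close>, hence than \<open>b\<close>, and
      \<open>?M\<close> is 0.\<close>
    have "?M * (y - s) \<le> 0"
    proof (cases "s \<le> y")
      case True
      then show ?thesis using False less.prems ty by (simp add: max_def)
    qed (simp add: mult_nonneg_nonpos)
    moreover have "Phi b (- b) \<le> Phi b (0 - s)" using less.prems by (intro Phi_mono) auto
    ultimately have "packs (s # xs) (cap 0)"
      using less.prems by (intro packs_lower_cap[where b = b]) auto
    then show ?thesis using packs_mono cap_mono less.prems by blast
  next
    case True
    have r: "reach y s = half y" using True s by (intro reach_pos) auto
    show ?thesis
    proof (rule packs_cap_step)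
      show "desc (s # xs)" "- 1 \<le> y - s" "y \<le> 1" "s \<le> 2 * reach y s" using less.prems True r by auto
      fix c zs
      assume c: "desc (c # zs)" "c \<le> s" and len: "length zs < length xs"
        and ar: "total_area (c # zs) \<le> total_area (s # xs) - s\<^sup>2 - c * max 0 (reach y s + reach y c - s - c)"
      have c0: "0 < c" using c by (simp add: desc_Cons)
      have "reach y c = half y" using c c0 True by (intro reach_pos) auto
      then have "c * ?M \<le> c\<^sup>2 + c * max 0 ((reach y s + reach y c) - s - c)"
        using c0 r ty less.prems by (intro mult_le_square_plus) auto
      then have "total_area (c # zs) < c\<^sup>2 + ?M * (y - s - c) + Phi b (- b)"
        using ar less.prems(6) by (simp add: algebra_simps)
      then show "packs (c # zs) (cap (y - s))"
        using c less.prems s True by (intro less.hyps[OF len]) auto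
    qed
  qed
qed

definition good :: "real \<Rightarrow> real \<Rightarrow> real \<Rightarrow> real \<Rightarrow> bool" where
  "good y a b N \<longleftrightarrow> (\<forall>s xs. desc (s # xs) \<and> a \<le> s \<and> s \<le> b \<and> total_area (s # xs) < N \<longrightarrow> packs (s # xs) (cap y))"

lemma good_mono: "good y a b N \<Longrightarrow> y \<le> y' \<Longrightarrow> N' \<le> N \<Longrightarrow> good y' a b N'"
  unfolding good_def by (meson packs_mono cap_mono less_le_trans)

text \<open>Vacuous: the first square alone has area at least a^2.\<close>

lemma good_trivial: "0 \<le> a \<Longrightarrow> N \<le> a\<^sup>2 \<Longrightarrow> good y a b N"
  unfolding good_def
proof (intro allI impI, elim conjE)
  fix s xs assume *: "0 \<le> a" "N \<le> a\<^sup>2" "a \<le> s" "total_area (s # xs) < N"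
  then have "a\<^sup>2 \<le> s\<^sup>2" by (intro power_mono)
  then have False using * total_area_nonneg[of xs] unfolding total_area_simps by linarith
  then show "packs (s # xs) (cap y)" ..
qed

lemma good_lower:
  assumes "0 \<le> a" "y \<le> 0" "N \<le> a\<^sup>2 + Phi b (y - b)"
  shows "good y a b N"
  unfolding good_def
proof (intro allI impI, elim conjE)
  fix s xs assume *: "desc (s # xs)" "a \<le> s" "s \<le> b" "total_area (s # xs) < N"
  have "a\<^sup>2 \<le> s\<^sup>2" using * assms by (intro power_mono) auto
  moreover have "Phi b (y - b) \<le> Phi b (y - s)" using * by (intro Phi_mono) auto
  ultimately have "total_area (s # xs) < s\<^sup>2 + Phi b (y - s)" using *(4) assms(3) by linarith
  then show "packs (s # xs) (cap y)" using * assms by (intro packs_lower_cap)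
qed

lemma good_upper:
  assumes "0 \<le> a" "0 \<le> y" "y \<le> 1" "N \<le> a\<^sup>2 + max 0 (2 * half y - b) * (y - b) + Phi b (- b)"
  shows "good y a b N"
  unfolding good_def
proof (intro allI impI, elim conjE)
  fix s xs assume *: "desc (s # xs)" "a \<le> s" "s \<le> b" "total_area (s # xs) < N"
  have "a\<^sup>2 \<le> s\<^sup>2" using * assms by (intro power_mono) auto
  moreover have "max 0 (2 * half y - b) * (y - b) \<le> max 0 (2 * half y - b) * (y - s)"
    using * by (intro mult_left_mono) auto
  ultimately have "total_area (s # xs) < s\<^sup>2 + max 0 (2 * half y - b) * (y - s) + Phi b (- b)"
    using *(4) assms(4) by linarith
  then show "packs (s # xs) (cap y)" using * assms by (intro packs_upper_cap) auto
qed

text \<open>The recursion of the dynamic program. Only bounds on the first square are known, so its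
  area is rounded down to a^2, its height up to \<open>b\<close> and its reach down to
  \<open>reach y b\<close>; the next line thus sinks to \<open>y - b\<close>. The head
  \<open>c\<close> of the next row is unknown, so each possible value must lie in a bracket for
  which the remaining area is already known to fit.\<close>

lemma good_row:
  assumes a: "0 \<le> a" and fit: "- 1 \<le> y - b" "y \<le> 1" "b \<le> 2 * reach y b"
    and cover: "\<And>c. 0 < c \<Longrightarrow> c \<le> b \<Longrightarrow> \<exists>c1 c2. 0 \<le> c1 \<and> c1 \<le> c \<and> c \<le> c2 \<and>
      good (y - b) c1 c2 (N - a\<^sup>2 - c1 * max 0 (reach y b + reach y c2 - b - c2))"
  shows "good y a b N"
  unfolding good_def
proof (intro allI impI, elim conjE)
  fix s xs assume *: "desc (s # xs)" "a \<le> s" "s \<le> b" "total_area (s # xs) < N"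
  have s: "0 < s" using * by (simp add: desc_Cons)
  have as: "a\<^sup>2 \<le> s\<^sup>2" using * a by (intro power_mono) auto
  have rb: "reach y b \<le> reach y s" using * s by (intro reach_antimono) auto
  show "packs (s # xs) (cap y)"
  proof (rule packs_cap_step[OF *(1)])
    show "- 1 \<le> y - s" "y \<le> 1" "s \<le> 2 * reach y s" using * fit rb by auto
    fix c zs
    assume c: "desc (c # zs)" "c \<le> s"
      and ar: "total_area (c # zs) \<le> total_area (s # xs) - s\<^sup>2 - c * max 0 (reach y s + reach y c - s - c)"
    have c0: "0 < c" using c by (simp add: desc_Cons)
    obtain c1 c2 where cc: "0 \<le> c1" "c1 \<le> c" "c \<le> c2"
      "good (y - b) c1 c2 (N - a\<^sup>2 - c1 * max 0 (reach y b + reach y c2 - b - c2))"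
      using cover[of c] c c0 * by auto
    have "reach y c2 \<le> reach y c" using cc c0 by (intro reach_antimono) auto
    then have "c1 * max 0 (reach y b + reach y c2 - b - c2) \<le> c * max 0 (reach y s + reach y c - s - c)"
      using cc rb * by (intro mult_mono) auto
    then have "total_area (c # zs) < N - a\<^sup>2 - c1 * max 0 (reach y b + reach y c2 - b - c2)"
      using ar as * by linarith
    then have "packs (c # zs) (cap (y - b))" using cc c unfolding good_def by blast
    then show "packs (c # zs) (cap (y - s))" by (rule packs_mono[OF _ cap_mono]) (use * in simp)
  qed
qed

section \<open>Starting configurations in the disk\<close>

text \<open>Reflection in the real axis turns standing on \<open>y\<close> into hanging from
  \<open>- y\<close>, which explains the argument of \<open>reach\<close>.\<close>

lemma square_on_line:
  assumes "- reach (- y) s \<le> x" "x + s \<le> reach (- y) s" "0 < s" "- 1 \<le> y" "y + s \<le> 1"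
  shows "square (x, y, s) \<subseteq> cball 0 1 \<inter> {z. y \<le> Im z}"
proof -
  have "reach (y + s) s = reach (- y) s"
    using assms(3) by (simp add: reach_def max.commute abs_minus_commute[of "- y" s] add.commute)
  then have "square (x, y + s - s, s) \<subseteq> cball 0 1 \<inter> {z. y + s - s \<le> Im z \<and> Im z \<le> y + s}"
    using assms by (intro square_in_strip) auto
  then show ?thesis by auto
qed

text \<open>The conditions on the line involve only the upper bound \<open>b\<close>, so that one
  line serves a whole bracket of sides.\<close>

lemma packs_one_on_top:
  assumes "desc (s # xs)" "s \<le> b" "- 1 \<le> y" "y + b \<le> 1" "b \<le> 2 * reach (- y) b" "packs xs (cap y)"
  shows "packs (s # xs) (cball 0 1)"
proof -
  have s: "0 < s" "\<forall>x\<in>set xs. 0 < x" using assms(1) by (auto simp: desc_def)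
  have "reach (- y) b \<le> reach (- y) s" using s assms by (intro reach_antimono) auto
  then have "square (- s / 2, y, s) \<subseteq> cball 0 1 \<inter> {z. y \<le> Im z}"
    using s assms by (intro square_on_line) auto
  then have "packs ([s] @ xs) (cball 0 1)"
    using s assms(6)
    by (intro packs_above_below[where c = y, OF packs_single]) (auto simp: cap_def)
  then show ?thesis by simp
qed

lemma packs_two_on_top:
  assumes "desc (s # t # xs)" "s \<le> b" "t \<le> c" "- 1 \<le> y" "y + b \<le> 1" "y + c \<le> 1"
    and "b \<le> 2 * reach (- y) b" "c \<le> 2 * reach (- y) c" "b + c \<le> reach (- y) b + reach (- y) c"
    and "packs xs (cap y)"
  shows "packs (s # t # xs) (cball 0 1)"
proof -
  have s: "0 < s" "0 < t" "\<forall>x\<in>set xs. 0 < x" using assms(1) by (auto simp: desc_def)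
  have r: "reach (- y) b \<le> reach (- y) s" "reach (- y) c \<le> reach (- y) t"
    using s assms by (auto intro!: reach_antimono)
  let ?R = "cball 0 1 \<inter> {z. y \<le> Im z}"
  \<comment> \<open>\<open>s\<close> is flush left at the position computed for \<open>b\<close>,
    and \<open>t\<close> flush right at the one computed for \<open>c\<close>; the bound on
    \<open>b + c\<close> keeps them apart.\<close>
  have "square (- reach (- y) b, y, s) \<subseteq> ?R"
    by (rule square_on_line) (use s assms r in auto)
  moreover have "square (reach (- y) c - t, y, t) \<subseteq> ?R"
    by (rule square_on_line) (use s assms r in auto)
  moreover have "apart (- reach (- y) b, y, s) (reach (- y) c - t, y, t)"
    using assms by auto
  ultimately have "packs [s, t] ?R"
    unfolding packs_def
    by (intro exI[of _ "[(- reach (- y) b, y, s), (reach (- y) c - t, y, t)]"]) auto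
  then have "packs ([s, t] @ xs) (cball 0 1)"
    using s assms(10) by (intro packs_above_below[where c = y]) (auto simp: cap_def)
  then show ?thesis by simp
qed

text \<open>The row argument with constant width. For \<open>b = s\<close> this is the Meir-Moser
  bound s^2 + (w - s) (h - s), here with strict inequality; a separate \<open>b\<close> is needed
  because it stays fixed in the induction while the leading side shrinks.\<close>

lemma packs_rectangle:
  assumes "desc (s # xs)" "s \<le> b" "b \<le> w" "total_area (s # xs) < s\<^sup>2 + (w - b) * (h - s)"
  shows "packs (s # xs) {z. x \<le> Re z \<and> Re z \<le> x + w \<and> y - h \<le> Im z \<and> Im z \<le> y}"
  using assms
proof (induction "length xs" arbitrary: s xs y h rule: less_induct)
  case less
  let ?R = "\<lambda>y h. {z. x \<le> Re z \<and> Re z \<le> x + w \<and> y - h \<le> Im z \<and> Im z \<le> y}"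
  have s: "0 < s" using less.prems by (simp add: desc_Cons)
  have sh: "s < h"
  proof (rule ccontr)
    assume "\<not> s < h"
    then have "(w - b) * (h - s) \<le> 0" using less.prems by (simp add: mult_nonneg_nonpos)
    then show False using less.prems total_area_nonneg[of xs] by simp
  qed
  let ?P = "\<lambda>us t. sum_list us + t \<le> w"
  obtain ys zs where yz: "s # xs = ys @ zs" "ys \<noteq> []" "\<And>us t vs. ys = us @ t # vs \<Longrightarrow> ?P us t"
    "zs = [] \<or> \<not> ?P ys (hd zs)"
    by (rule greedy_prefix[of ?P s xs]) (use less.prems in simp, blast)
  have dy: "desc ys" "\<forall>t\<in>set ys. t \<le> s"
  proof -
    show "desc ys" using less.prems yz(1) by (simp add: desc_append)
    have "\<forall>t\<in>set (s # xs). t \<le> s" using less.prems by (simp add: desc_Cons)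
    then show "\<forall>t\<in>set ys. t \<le> s" unfolding yz(1) by simp
  qed
  have py: "packs ys (?R y s)"
  proof (rule packs_row[of _ x y])
    show "\<forall>s\<in>set ys. 0 < s" using dy by (simp add: desc_def)
    fix us t vs assume *: "ys = us @ t # vs"
    have t: "0 < t" "t \<le> s" "\<forall>u\<in>set us. 0 < u" using * dy by (auto simp: desc_def)
    have "0 \<le> sum_list us" by (rule sum_list_nonneg) (use t(3) in force)
    then show "square (x + sum_list us, y - t, t) \<subseteq> ?R y s"
      using yz(3)[OF *] t by (auto simp: mem_square)
  qed
  have pz: "packs zs (?R (y - s) (h - s))"
  proof (cases zs)
    case (Cons c zs')
    obtain ys' where ys': "ys = s # ys'" using yz(1,2) by (cases ys) auto
    have d: "desc (s # ys' @ c # zs')" using less.prems yz(1) ys' Cons by simp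
    then have c: "desc (c # zs')" "c \<le> s" "0 < c" by (auto simp: desc_Cons desc_append)
    have "s\<^sup>2 + c * max 0 (w - s - c) \<le> total_area ys"
      using row_area[OF d, of w] yz(4) ys' Cons by auto
    moreover have "total_area (s # xs) = total_area ys + total_area zs"
      using yz(1) total_area_simps(3) by metis
    moreover have "c * max 0 (w - b) \<le> c\<^sup>2 + c * max 0 (w - s - c)"
      using c less.prems by (intro mult_le_square_plus) auto
    ultimately have "total_area (c # zs') < c\<^sup>2 + (w - b) * (h - s - c)"
      using less.prems Cons by (simp add: algebra_simps max_def)
    then show ?thesis
      using c less.prems arg_cong[OF yz(1), of length] ys' Cons unfolding Cons
      by (intro less.hyps) auto
  qed simp
  have "\<forall>x\<in>set (ys @ zs). 0 < x" using less.prems yz(1) by (metis desc_def)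
  then have "packs (ys @ zs) (?R y h)"
    using py pz s sh by (intro packs_above_below[where c = "y - s"]) auto
  then show ?case using yz(1) by simp
qed

text \<open>After squaring, the claim splits into (5/4) (s^2 + t^2) <= 2 and
  \<open>s * t \<le> half (s / 2) * half (t / 2)\<close>. Squaring the second reduces it to (15/16)
  (s t)^2 <= 1 - (s^2 + t^2) / 4, which follows from s t <= 4/5. All of these are equalities for s^2
  = t^2 = 4/5.\<close>

lemma stacked_squares_fit:
  fixes s t :: real
  assumes "s\<^sup>2 + t\<^sup>2 \<le> 8 / 5" "0 \<le> s" "0 \<le> t"
  shows "s + t \<le> half (s / 2) + half (t / 2)"
proof -
  have st: "s * t \<le> 4 / 5" using assms(1) sum_squares_bound[of s t] by simp
  have le1: "\<bar>s / 2\<bar> \<le> 1" "\<bar>t / 2\<bar> \<le> 1"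
  proof -
    have "s\<^sup>2 \<le> 4" "t\<^sup>2 \<le> 4"
      using assms(1) zero_le_power2[of s] zero_le_power2[of t] by linarith+
    then have "s \<le> 2" "t \<le> 2"
      using power2_le_imp_le[of s 2] power2_le_imp_le[of t 2] by simp_all
    then show "\<bar>s / 2\<bar> \<le> 1" "\<bar>t / 2\<bar> \<le> 1" using assms by auto
  qed
  have "(s * t)\<^sup>2 \<le> (4 / 5)\<^sup>2" using st assms by (intro power_mono) auto
  then have st2: "(s * t)\<^sup>2 \<le> 16 / 25" by (simp add: power2_eq_square)
  have "(half (s / 2) * half (t / 2))\<^sup>2 = (1 - (s / 2)\<^sup>2) * (1 - (t / 2)\<^sup>2)"
    using le1 by (simp only: power_mult_distrib half_sq)
  moreover have "(1 - (s / 2)\<^sup>2) * (1 - (t / 2)\<^sup>2) = 1 - (s\<^sup>2 + t\<^sup>2) / 4 + (s * t)\<^sup>2 / 16"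
    by (simp add: power2_eq_square algebra_simps)
  ultimately have h2: "(half (s / 2) * half (t / 2))\<^sup>2 = 1 - (s\<^sup>2 + t\<^sup>2) / 4 + (s * t)\<^sup>2 / 16"
    by simp
  have "(s * t)\<^sup>2 \<le> (half (s / 2) * half (t / 2))\<^sup>2"
  proof -
    have "q \<le> 1 - p / 4 + q / 16" if "q \<le> 16 / 25" "p \<le> 8 / 5" for p q :: real
      using that by (simp add: field_simps)
    then show ?thesis unfolding h2 using st2 assms(1) by blast
  qed
  then have "s * t \<le> half (s / 2) * half (t / 2)"
    by (rule power2_le_imp_le) (intro mult_nonneg_nonneg half_nonneg le1)
  then have "s\<^sup>2 + t\<^sup>2 + 2 * (s * t) \<le> 2 - (s\<^sup>2 + t\<^sup>2) / 4 + 2 * (half (s / 2) * half (t / 2))"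
    using assms(1) by (simp add: field_simps)
  moreover have "(half (s / 2) + half (t / 2))\<^sup>2 = 2 - (s\<^sup>2 + t\<^sup>2) / 4 + 2 * (half (s / 2) * half (t / 2))"
    unfolding power2_sum half_sq[OF le1(1)] half_sq[OF le1(2)] by (simp add: power_divide add_divide_distrib)
  moreover have "(s + t)\<^sup>2 = s\<^sup>2 + t\<^sup>2 + 2 * (s * t)" by (simp add: power2_sum)
  ultimately have "(s + t)\<^sup>2 \<le> (half (s / 2) + half (t / 2))\<^sup>2"
    by (simp only:)
  then show ?thesis
    by (rule power2_le_imp_le) (intro add_nonneg_nonneg half_nonneg le1)
qed

text \<open>The two upper corners lie on the circle. The condition s^2 <= 2 says that the square is
  at most the inscribed one, so that its lower corners are no farther from the centre.\<close>

lemma square_touching_top: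
  assumes "0 < s" "s\<^sup>2 \<le> 2"
  shows "square (- s / 2, half (s / 2) - s, s) \<subseteq> cball 0 1 \<inter> {z. Re z \<le> s / 2 \<and> half (s / 2) - s \<le> Im z}"
proof
  fix z assume "z \<in> square (- s / 2, half (s / 2) - s, s)"
  then have z: "\<bar>Re z\<bar> \<le> s / 2" "half (s / 2) - s \<le> Im z" "Im z \<le> half (s / 2)" by (auto simp: mem_square)
  have "s \<le> 2" using assms power2_le_imp_le[of s 2] by simp
  then have s2: "\<bar>s / 2\<bar> \<le> 1" using assms by auto
  then have h: "(half (s / 2))\<^sup>2 = 1 - (s / 2)\<^sup>2" by (rule half_sq)
  have "(s / 2)\<^sup>2 \<le> (half (s / 2))\<^sup>2" unfolding h using assms by (simp add: power2_eq_square)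
  then have "s / 2 \<le> half (s / 2)" using half_nonneg[OF s2] by (rule power2_le_imp_le)
  then have "\<bar>Im z\<bar> \<le> half (s / 2)" using z by auto
  then have "(Im z)\<^sup>2 \<le> (half (s / 2))\<^sup>2" by (rule abs_le_square_iff[THEN iffD1, OF order_trans]) simp
  moreover have "(Re z)\<^sup>2 \<le> (s / 2)\<^sup>2" using z(1) by (rule abs_le_square_iff[THEN iffD1, OF order_trans]) simp
  ultimately have "z \<in> cball 0 1" unfolding mem_disk using h by linarith
  then show "z \<in> cball 0 1 \<inter> {z. Re z \<le> s / 2 \<and> half (s / 2) - s \<le> Im z}" using z by auto
qed

text \<open>The stack lies to the left of the line Re z = b/2. To its right a rectangle of width
  \<open>w\<close> and height 4/5, centred at the real axis, stays in the disk as long as its right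
  corners at heights 2/5 and -2/5 do.\<close>

lemma packs_two_stacked:
  assumes "desc (s # t # xs)" "total_area (s # t # xs) \<le> 8 / 5" "s \<le> b" "0 \<le> w" "w + b / 2 \<le> half (2 / 5)"
    and "total_area xs < w\<^sup>2" "total_area xs < 4 / 5 * w - (w + 4 / 5)\<^sup>2 / 8"
  shows "packs (s # t # xs) (cball 0 1)"
proof -
  have pos: "0 < s" "0 < t" "t \<le> s" "\<forall>x\<in>set xs. 0 < x" using assms(1) by (auto simp: desc_def)
  have st: "s\<^sup>2 + t\<^sup>2 \<le> 8 / 5" using assms(2) total_area_nonneg[of xs] by simp
  have sq: "s\<^sup>2 \<le> 2" "t\<^sup>2 \<le> 2" using st zero_le_power2[of s] zero_le_power2[of t] by linarith+
  have le: "t - half (t / 2) \<le> half (s / 2) - s" using stacked_squares_fit[OF st] pos by simp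
  let ?D = "cball (0 :: complex) 1"
  have upper: "packs [s] (?D \<inter> {z. Re z \<le> b / 2 \<and> half (s / 2) - s \<le> Im z})"
    using square_touching_top[OF pos(1) sq(1)] assms(3) by (intro packs_single) force
  have "packs [t] (?D \<inter> {z. Re z \<le> t / 2 \<and> half (t / 2) - t \<le> Im z})"
    using square_touching_top[OF pos(2) sq(2)] by (intro packs_single)
  then have "packs [t] (cnj ` (?D \<inter> {z. Re z \<le> t / 2 \<and> half (t / 2) - t \<le> Im z}))"
    by (rule packs_mirror)
  then have lower: "packs [t] (?D \<inter> {z. Re z \<le> b / 2 \<and> Im z \<le> half (s / 2) - s})"
    by (rule packs_mono) (use le pos assms(3) in auto)
  have left: "packs ([s] @ [t]) (?D \<inter> {z. Re z \<le> b / 2})"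
    using upper lower pos by (intro packs_above_below[where c = "half (s / 2) - s"]) auto
  have right: "packs xs (?D \<inter> {z. b / 2 \<le> Re z})"
  proof (cases xs)
    case (Cons u ys)
    have u: "0 < u" "desc (u # ys)" using assms(1) Cons by (auto simp: desc_Cons)
    have "u\<^sup>2 \<le> total_area xs" using Cons total_area_nonneg[of ys] by simp
    then have "u\<^sup>2 \<le> w\<^sup>2" using assms(6) by linarith
    then have "u \<le> w" using assms(4) by (rule power2_le_imp_le)
    \<comment> \<open>the bound on the area is the minimum of this quadratic polynomial over u\<close>
    moreover have "u\<^sup>2 + (w - u) * (4 / 5 - u) = 4 / 5 * w - (w + 4 / 5)\<^sup>2 / 8 + 2 * (u - (w + 4 / 5) / 4)\<^sup>2"
      by (simp add: power2_eq_square field_simps)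
    then have "total_area (u # ys) < u\<^sup>2 + (w - u) * (4 / 5 - u)"
      using assms(7) zero_le_power2[of "u - (w + 4 / 5) / 4"] unfolding Cons by linarith
    ultimately have "packs xs {z. b / 2 \<le> Re z \<and> Re z \<le> b / 2 + w \<and> 2 / 5 - 4 / 5 \<le> Im z \<and> Im z \<le> 2 / 5}"
      unfolding Cons by (intro packs_rectangle[OF u(2)]) auto
    then show ?thesis
    proof (rule packs_mono)
      show "{z. b / 2 \<le> Re z \<and> Re z \<le> b / 2 + w \<and> 2 / 5 - 4 / 5 \<le> Im z \<and> Im z \<le> 2 / 5}
          \<subseteq> ?D \<inter> {z. b / 2 \<le> Re z}"
      proof
        fix z assume z: "z \<in> {z. b / 2 \<le> Re z \<and> Re z \<le> b / 2 + w \<and> 2 / 5 - 4 / 5 \<le> Im z \<and> Im z \<le> 2 / 5}"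
        then have "(Im z)\<^sup>2 \<le> (2 / 5)\<^sup>2" by (intro abs_le_square_iff[THEN iffD1]) auto
        moreover have "(Re z)\<^sup>2 \<le> (half (2 / 5))\<^sup>2" using z assms pos by (intro power_mono) auto
        ultimately have "z \<in> ?D" unfolding mem_disk by (simp add: half_sq)
        then show "z \<in> ?D \<inter> {z. b / 2 \<le> Re z}" using z by auto
      qed
    qed
  qed simp
  have "packs (([s] @ [t]) @ xs) ?D"
    by (rule packs_left_right[OF left right, where c = "b / 2"]) (use pos in auto)
  then show ?thesis by simp
qed

text \<open>Put the longest prefix that packs at all into the lower half disk. With the next square
  \<open>c\<close> it no longer packs, so its area is at least s^2 + Phi - c^2. The rest therefore
  has area less than c^2 + Phi, which is just the bound for a half disk when \<open>c\<close> is its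
  largest square.\<close>

lemma packs_two_halves:
  assumes d: "desc (s # xs)" and b: "s \<le> b" and ar: "total_area (s # xs) < s\<^sup>2 + 2 * Phi b (- b)"
  shows "packs (s # xs) (cball 0 1)"
proof -
  define N where "N = length (s # xs)"
  define n where "n = Max {n. n \<le> N \<and> packs (take n (s # xs)) (cap 0)}"
  let ?A = "{n. n \<le> N \<and> packs (take n (s # xs)) (cap 0)}"
  have fin: "finite ?A" by auto
  have "0 \<in> ?A" by simp
  then have n: "n \<in> ?A" "\<And>m. m \<in> ?A \<Longrightarrow> m \<le> n"
    unfolding n_def using Max_in[OF fin] Max_ge[OF fin] by blast+
  let ?ys = "take n (s # xs)" and ?zs = "drop n (s # xs)"
  have d2: "desc ?ys" "desc ?zs" using d by (metis append_take_drop_id desc_append)+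
  have mono: "Phi b (- b) \<le> Phi b (0 - t)" if "t \<le> b" for t using that by (intro Phi_mono) auto
  have "packs ?zs (cap 0)"
  proof (cases "n = N")
    case False
    then have lt: "n < N" using n by auto
    then obtain c zs where z: "?zs = c # zs" by (cases ?zs) (auto simp: N_def)
    have tk: "take (Suc n) (s # xs) = ?ys @ [c]"
      using take_hd_drop[of n "s # xs"] lt z by (simp add: N_def)
    have "\<not> packs (take (Suc n) (s # xs)) (cap 0)" using n(2)[of "Suc n"] lt by auto
    moreover have "desc (take (Suc n) (s # xs))" using d by (metis append_take_drop_id desc_append)
    ultimately have "s\<^sup>2 + Phi b (- b) \<le> total_area (take (Suc n) (s # xs))"
      using packs_lower_cap[of s "take n xs" b 0] b mono[OF b] by force
    then have "s\<^sup>2 + Phi b (- b) \<le> total_area ?ys + c\<^sup>2" unfolding tk by simp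
    moreover have "total_area (s # xs) = total_area ?ys + total_area ?zs"
      using total_area_simps(3)[of ?ys ?zs] by simp
    ultimately have "total_area ?zs < c\<^sup>2 + Phi b (- b)" using ar by linarith
    moreover have "c \<in> set (s # xs)" using z by (metis in_set_dropD list.set_intros(1))
    then have "c \<le> b" using d b by (auto simp: desc_Cons)
    ultimately show ?thesis
      using d2(2) mono[of c] unfolding z by (intro packs_lower_cap[where b = b]) auto
  qed (simp add: N_def)
  then have "packs ?zs (cnj ` cap 0)" by (rule packs_mirror)
  then have "packs (?zs @ ?ys) (cball 0 1)"
    using n(1) d2 by (intro packs_above_below[where c = 0]) (auto simp: cap_def desc_def)
  then show ?thesis
    by (rule packs_mset) (metis append_take_drop_id mset_append union_commute)
qed

section \<open>Integer bounds\<close>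

text \<open>From here on integers stand for real numbers: a line y for the height y/50, an index k for
  the sides in the bracket from k/50 to (k + 1)/50, an area n for n/100000, and a half chord for
  its length times 1000; the arguments of \<open>hf\<close> and \<open>chord_area\<close> are distances from
  the centre in units of 1/100. The following tables serve as certificates, and every
  property of them that matters is checked by evaluation.

  The entry n of \<open>half_table\<close> is 1000 sqrt (1 - (n/100)^2), rounded down; \<open>area_table\<close> consists of the
  trapezoidal sums for the area of the disk between the heights 0 and n/100; \<open>cutoff_table\<close>
  contains the distance beyond which chords are shorter than the side (k + 1)/50; and \<open>cap_row\<close> is the
  solution of the dynamic program: squares of total area less than entry k of the row y whose largest side
  belongs to k fit below the line y.\<close>

definition half_table :: "int list" where
  "half_table = [
    1000, 999, 999, 999, 999, 998, 998, 997, 996, 995, 994, 993, 992, 991, 990, 988, 987, 985,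
    983, 981, 979, 977, 975, 973, 970, 968, 965, 962, 960, 957, 953, 950, 947, 943, 940, 936,
    932, 929, 924, 920, 916, 912, 907, 902, 897, 893, 887, 882, 877, 871, 866, 860, 854, 847,
    841, 835, 828, 821, 814, 807, 800, 792, 784, 776, 768, 759, 751, 742, 733, 723, 714, 704,
    693, 683, 672, 661, 649, 638, 625, 613, 600, 586, 572, 557, 542, 526, 510, 493, 474, 455,
    435, 414, 391, 367, 341, 312, 280, 243, 198, 141, 0]"

definition area_table :: "int list" where
  "area_table = [
    0, 1999, 3997, 5995, 7993, 9990, 11986, 13981, 15974, 17965, 19954, 21941, 23926, 25909,
    27890, 29868, 31843, 33815, 35783, 37747, 39707, 41663, 43615, 45563, 47506, 49444, 51377,
    53304, 55226, 57143, 59053, 60956, 62853, 64743, 66626, 68502, 70370, 72231, 74084, 75928,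
    77764, 79592, 81411, 83220, 85019, 86809, 88589, 90358, 92117, 93865, 95602, 97328, 99042,
    100743, 102431, 104107, 105770, 107419, 109054, 110675, 112282, 113874, 115450, 117010,
    118554, 120081, 121591, 123084, 124559, 126015, 127452, 128870, 130267, 131643, 132998,
    134331, 135641, 136928, 138191, 139429, 140642, 141828, 142986, 144115, 145214, 146282,
    147318, 148321, 149288, 150217, 151107, 151956, 152761, 153519, 154227, 154880, 155472,
    155995, 156436, 156775, 156916]"

definition cutoff_table :: "int list" where
  "cutoff_table = [
    100, 100, 100, 100, 100, 100, 100, 99, 99, 99, 99, 99, 99, 99, 99, 99, 98, 98, 98, 98, 98,
    98, 97, 97, 97, 97, 96, 96, 96, 95, 95, 95, 94, 94, 94, 93, 93, 92, 92, 92, 91, 91, 90]"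

definition cap_row :: "int \<Rightarrow> int list" where
  "cap_row y = (
  if y = - 44 then [
    5609, 3875, 2489, 1484, 920, 1000, 1440, 1960, 2560, 3240, 4000, 4840, 5760, 6760, 7840,
    9000, 10240, 11560, 12960, 14440, 16000, 17640, 19360, 21160, 23040, 25000, 27040, 29160,
    31360, 33640, 36000, 38440, 40960, 43560, 46240, 49000, 51840, 54760, 57760, 60840, 64000,
    67240, 70560] else
  if y = - 43 then [
    7388, 5449, 3835, 2569, 1684, 1240, 1440, 1960, 2560, 3240, 4000, 4840, 5760, 6760, 7840,
    9000, 10240, 11560, 12960, 14440, 16000, 17640, 19360, 21160, 23040, 25000, 27040, 29160,
    31360, 33640, 36000, 38440, 40960, 43560, 46240, 49000, 51840, 54760, 57760, 60840, 64000,
    67240, 70560] else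
  if y = - 42 then [
    9318, 7188, 5369, 3875, 2729, 1964, 1640, 1960, 2560, 3240, 4000, 4840, 5760, 6760, 7840,
    9000, 10240, 11560, 12960, 14440, 16000, 17640, 19360, 21160, 23040, 25000, 27040, 29160,
    31360, 33640, 36000, 38440, 40960, 43560, 46240, 49000, 51840, 54760, 57760, 60840, 64000,
    67240, 70560] else
  if y = - 41 then [
    11382, 9078, 7068, 5369, 3995, 2969, 2324, 2139, 2560, 3240, 4000, 4840, 5760, 6760, 7840,
    9000, 10240, 11560, 12960, 14440, 16000, 17640, 19360, 21160, 23040, 25000, 27040, 29160,
    31360, 33640, 36000, 38440, 40960, 43560, 46240, 49000, 51840, 54760, 57760, 60840, 64000,
    67240, 70560] else
  if y = - 40 then [
    13570, 11102, 8918, 7028, 5449, 4195, 3289, 2783, 2719, 3240, 4000, 4840, 5760, 6760, 7840,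
    9000, 10240, 11560, 12960, 14440, 16000, 17640, 19360, 21160, 23040, 25000, 27040, 29160,
    31360, 33640, 36000, 38440, 40960, 43560, 46240, 49000, 51840, 54760, 57760, 60840, 64000,
    67240, 70560] else
  if y = - 39 then [
    15874, 13250, 10902, 8838, 7068, 5609, 4475, 3708, 3323, 3379, 4000, 4840, 5760, 6760, 7840,
    9000, 10240, 11560, 12960, 14440, 16000, 17640, 19360, 21160, 23040, 25000, 27040, 29160,
    31360, 33640, 36000, 38440, 40960, 43560, 46240, 49000, 51840, 54760, 57760, 60840, 64000,
    67240, 70560] else
  if y = - 38 then [
    18285, 15514, 13010, 10782, 8838, 7188, 5849, 4854, 4208, 3943, 4119, 4840, 5760, 6760,
    7840, 9000, 10240, 11560, 12960, 14440, 16000, 17640, 19360, 21160, 23040, 25000, 27040,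
    29160, 31360, 33640, 36000, 38440, 40960, 43560, 46240, 49000, 51840, 54760, 57760, 60840,
    64000, 67240, 70560] else
  if y = - 37 then [
    20795, 17885, 15234, 12850, 10742, 8918, 7388, 6188, 5314, 4788, 4643, 4939, 5760, 6760,
    7840, 9000, 10240, 11560, 12960, 14440, 16000, 17640, 19360, 21160, 23040, 25000, 27040,
    29160, 31360, 33640, 36000, 38440, 40960, 43560, 46240, 49000, 51840, 54760, 57760, 60840,
    64000, 67240, 70560] else
  if y = - 36 then [
    23398, 20355, 17565, 15034, 12770, 10782, 9078, 7687, 6608, 5854, 5448, 5423, 5839, 6760,
    7840, 9000, 10240, 11560, 12960, 14440, 16000, 17640, 19360, 21160, 23040, 25000, 27040,
    29160, 31360, 33640, 36000, 38440, 40960, 43560, 46240, 49000, 51840, 54760, 57760, 60840,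
    64000, 67240, 70560] else
  if y = - 35 then [
    26089, 22918, 19995, 17325, 14914, 12770, 10902, 9348, 8169, 7108, 6474, 6188, 6283, 6819,
    7840, 9000, 10240, 11560, 12960, 14440, 16000, 17640, 19360, 21160, 23040, 25000, 27040,
    29160, 31360, 33640, 36000, 38440, 40960, 43560, 46240, 49000, 51840, 54760, 57760, 60840,
    64000, 67240, 70560] else
  if y = - 34 then [
    28864, 25569, 22518, 19715, 17165, 14874, 12850, 11218, 9948, 8849, 7688, 7174, 7008, 7223,
    7879, 9000, 10240, 11560, 12960, 14440, 16000, 17640, 19360, 21160, 23040, 25000, 27040,
    29160, 31360, 33640, 36000, 38440, 40960, 43560, 46240, 49000, 51840, 54760, 57760, 60840,
    64000, 67240, 70560] else
  if y = - 33 then [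
    31717, 28304, 25129, 22198, 19515, 17085, 14914, 13208, 11820, 10628, 9609, 8348, 7954,
    7908, 8243, 9019, 10240, 11560, 12960, 14440, 16000, 17640, 19360, 21160, 23040, 25000,
    27040, 29160, 31360, 33640, 36000, 38440, 40960, 43560, 46240, 49000, 51840, 54760, 57760,
    60840, 64000, 67240, 70560] else
  if y = - 32 then [
    34645, 31117, 27824, 24769, 21958, 19395, 17085, 15254, 13808, 12498, 11388, 10449, 9088,
    8814, 8888, 9343, 10240, 11560, 12960, 14440, 16000, 17640, 19360, 21160, 23040, 25000,
    27040, 29160, 31360, 33640, 36000, 38440, 40960, 43560, 46240, 49000, 51840, 54760, 57760,
    60840, 64000, 67240, 70560] else
  if y = - 31 then [
    37642, 34005, 30597, 27424, 24489, 21798, 19355, 17392, 15850, 14484, 13254, 12228, 11369,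
    9908, 9754, 9948, 10524, 11560, 12960, 14440, 16000, 17640, 19360, 21160, 23040, 25000,
    27040, 29160, 31360, 33640, 36000, 38440, 40960, 43560, 46240, 49000, 51840, 54760, 57760,
    60840, 64000, 67240, 70560] else
  if y = - 30 then [
    40706, 36962, 33445, 30157, 27104, 24289, 21718, 19594, 17986, 16522, 15238, 14088, 13148,
    12369, 10808, 10774, 11089, 11804, 12960, 14440, 16000, 17640, 19360, 21160, 23040, 25000,
    27040, 29160, 31360, 33640, 36000, 38440, 40960, 43560, 46240, 49000, 51840, 54760, 57760,
    60840, 64000, 67240, 70560] else
  if y = - 29 then [
    43834, 39986, 36362, 32965, 29797, 26864, 24169, 21862, 20182, 18654, 17270, 16068, 15000,
    14148, 13449, 11788, 11875, 12329, 13164, 14440, 16000, 17640, 19360, 21160, 23040, 25000,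
    27040, 29160, 31360, 33640, 36000, 38440, 40960, 43560, 46240, 49000, 51840, 54760, 57760,
    60840, 64000, 67240, 70560] else
  if y = - 28 then [
    47022, 43074, 39346, 35842, 32565, 29517, 26704, 24202, 22446, 20844, 19396, 18094, 16972,
    15992, 15228, 14609, 12849, 13075, 13649, 14604, 16000, 17640, 19360, 21160, 23040, 25000,
    27040, 29160, 31360, 33640, 36000, 38440, 40960, 43560, 46240, 49000, 51840, 54760, 57760,
    60840, 64000, 67240, 70560] else
  if y = - 27 then [
    50266, 46222, 42394, 38786, 35402, 32245, 29317, 26643, 24778, 23102, 21580, 20212, 18998,
    17956, 17060, 16377, 15849, 14009, 14355, 15049, 16124, 17640, 19360, 21160, 23040, 25000,
    27040, 29160, 31360, 33640, 36000, 38440, 40960, 43560, 46240, 49000, 51840, 54760, 57760,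
    60840, 64000, 67240, 70560] else
  if y = - 26 then [
    53565, 49426, 45502, 41794, 38306, 35042, 32005, 29216, 27150, 25426, 23830, 22396, 21108,
    19974, 19012, 18208, 17605, 17169, 15249, 15715, 16529, 17724, 19360, 21160, 23040, 25000,
    27040, 29160, 31360, 33640, 36000, 38440, 40960, 43560, 46240, 49000, 51840, 54760, 57760,
    60840, 64000, 67240, 70560] else
  if y = - 25 then [
    56914, 52685, 48666, 44862, 41274, 37906, 34762, 31864, 29582, 27790, 26152, 24638, 23280,
    22072, 21030, 20148, 19434, 18911, 18569, 16569, 17155, 18089, 19423, 21160, 23040, 25000,
    27040, 29160, 31360, 33640, 36000, 38440, 40960, 43560, 46240, 49000, 51840, 54760, 57760,
    60840, 64000, 67240, 70560] else
  if y = - 24 then [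
    60314, 55994, 51885, 47986, 44302, 40834, 37586, 34581, 32054, 30214, 28510, 26946, 25510,
    24244, 23116, 22162, 21360, 20740, 20297, 20049, 17969, 18675, 19748, 21203, 23040, 25000,
    27040, 29160, 31360, 33640, 36000, 38440, 40960, 43560, 46240, 49000, 51840, 54760, 57760,
    60840, 64000, 67240, 70560] else
  if y = - 23 then [
    63759, 59354, 55154, 51165, 47386, 43822, 40474, 37365, 34621, 32686, 30926, 29290, 27812,
    26462, 25282, 24234, 23374, 22652, 22124, 21761, 21609, 19449, 20294, 21488, 23063, 25000,
    27040, 29160, 31360, 33640, 36000, 38440, 40960, 43560, 46240, 49000, 51840, 54760, 57760,
    60840, 64000, 67240, 70560] else
  if y = - 22 then [
    67247, 62759, 58474, 54394, 50525, 46866, 43422, 40213, 37251, 35229, 33374, 31694, 30150,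
    28752, 27486, 26398, 25432, 24662, 24020, 23586, 23303, 23249, 21028, 21994, 23308, 25003,
    27040, 29160, 31360, 33640, 36000, 38440, 40960, 43560, 46240, 49000, 51840, 54760, 57760,
    60840, 64000, 67240, 70560] else
  if y = - 21 then [
    70777, 66207, 61839, 57674, 53714, 49965, 46426, 43121, 40033, 37859, 35917, 34142, 32542,
    31080, 29762, 28590, 27582, 26704, 26024, 25464, 25125, 24923, 24957, 22688, 23774, 25208,
    27040, 29160, 31360, 33640, 36000, 38440, 40960, 43560, 46240, 49000, 51840, 54760, 57760,
    60840, 64000, 67240, 70560] else
  if y = - 20 then [
    74345, 69697, 65247, 60999, 56954, 53114, 49485, 46085, 42901, 40570, 38535, 36673, 34978,
    33458, 32090, 30852, 29766, 28838, 28050, 27450, 26984, 26725, 26623, 26737, 24428, 25634,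
    27205, 29160, 31360, 33640, 36000, 38440, 40960, 43560, 46240, 49000, 51840, 54760, 57760,
    60840, 64000, 67240, 70560] else
  if y = - 19 then [
    77952, 73225, 68697, 64367, 60239, 56314, 52594, 49104, 45825, 43232, 41246, 39291, 37509,
    35894, 34454, 33170, 32012, 31014, 30166, 29470, 28950, 28584, 28405, 28403, 28597, 26248,
    27591, 29285, 31360, 33640, 36000, 38440, 40960, 43560, 46240, 49000, 51840, 54760, 57760,
    60840, 64000, 67240, 70560] else
  if y = - 18 then [
    81592, 76792, 72185, 67777, 63567, 59559, 55754, 52173, 48804, 45950, 43894, 41990, 40115,
    38413, 36878, 35518, 34320, 33242, 32334, 31566, 30970, 30530, 30264, 30165, 30261, 30535,
    28165, 29631, 31445, 33640, 36000, 38440, 40960, 43560, 46240, 49000, 51840, 54760, 57760,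
    60840, 64000, 67240, 70560] else
  if y = - 17 then [
    85266, 80392, 75712, 71225, 66937, 62847, 58959, 55293, 51833, 48741, 46598, 44622, 42798,
    41007, 39385, 37930, 36650, 35540, 34542, 33734, 33046, 32550, 32190, 32020, 32001, 32197,
    32551, 30165, 31751, 33693, 36000, 38440, 40960, 43560, 46240, 49000, 51840, 54760, 57760,
    60840, 64000, 67240, 70560] else
  if y = - 16 then [
    88970, 84026, 79272, 74712, 70345, 66177, 62207, 58458, 54913, 51650, 49375, 47312, 45416,
    43672, 41967, 40425, 39050, 37850, 36834, 35922, 35208, 34606, 34204, 33924, 33852, 33913,
    34211, 34647, 32245, 33959, 36033, 38440, 40960, 43560, 46240, 49000, 51840, 54760, 57760,
    60840, 64000, 67240, 70560] else
  if y = - 15 then [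
    92703, 87690, 82866, 78232, 73792, 69545, 65497, 61666, 58038, 54613, 52270, 50075, 48092,
    46276, 44612, 43007, 41545, 40250, 39130, 38194, 37382, 36748, 36238, 35916, 35732, 35745,
    35905, 36283, 36823, 34413, 36259, 38453, 40960, 43560, 46240, 49000, 51840, 54760, 57760,
    60840, 64000, 67240, 70560] else
  if y = - 14 then [
    96463, 91383, 86490, 81786, 77272, 72952, 68825, 64916, 61206, 57698, 55226, 52970, 50855,
    48952, 47216, 45632, 44127, 42745, 41530, 40490, 39634, 38912, 38358, 37942, 37700, 37620,
    37713, 37977, 38435, 39077, 36673, 38639, 40960, 43560, 46240, 49000, 51840, 54760, 57760,
    60840, 64000, 67240, 70560] else
  if y = - 13 then [
    100250, 95103, 90143, 85370, 80786, 76392, 72192, 68204, 64416, 60826, 58038, 55910, 53750,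
    51715, 49892, 48236, 46732, 45315, 44013, 42878, 41918, 41142, 40512, 40038, 39726, 39564,
    39588, 39761, 40125, 40663, 41409, 39013, 41106, 43560, 46240, 49000, 51840, 54760, 57760,
    60840, 64000, 67240, 70560] else
  if y = - 12 then [
    104059, 98850, 93823, 88983, 84330, 79866, 75592, 71531, 67664, 63996, 60925, 58718, 56670,
    54596, 52641, 50898, 49322, 47898, 46571, 45349, 44294, 43414, 42718, 42192, 41798, 41590,
    41508, 41630, 41883, 42349, 42967, 43823, 41440, 43666, 46240, 49000, 51840, 54760, 57760,
    60840, 64000, 67240, 70560] else
  if y = - 11 then [
    107890, 102619, 97530, 92623, 87903, 83370, 79026, 74891, 70951, 67204, 63859, 61589, 59462,
    57494, 55508, 53633, 51970, 50474, 49130, 47904, 46765, 45790, 44990, 44374, 43938, 43638,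
    43518, 43524, 43745, 44079, 44645, 45355, 46305, 43960, 46306, 49000, 51840, 54760, 57760,
    60840, 64000, 67240, 70560] else
  if y = - 10 then [
    111741, 106410, 101259, 96290, 91503, 86903, 82490, 78285, 74271, 70451, 66929, 64507,
    62317, 60270, 58382, 56500, 54705, 53122, 51706, 50442, 49296, 48261, 47366, 46646, 46110,
    45754, 45548, 45508, 45612, 45913, 46361, 47007, 47815, 48845, 46560, 49038, 51840, 54760,
    57760, 60840, 64000, 67240, 70560] else
  if y = - 9 then [
    115609, 110221, 105010, 99979, 95130, 90463, 85983, 81709, 77625, 73731, 70069, 67577,
    65235, 63125, 61158, 59350, 57572, 55857, 54354, 53018, 51834, 50768, 49825, 49010, 48370,
    47914, 47638, 47528, 47568, 47788, 48169, 48711, 49437, 50355, 51465, 49252, 51858, 54760,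
    57760, 60840, 64000, 67240, 70560] else
  if y = - 8 then [
    119493, 114049, 108781, 103690, 98779, 94050, 89503, 85162, 81009, 77045, 73271, 70717,
    68305, 66043, 64013, 62126, 60398, 58710, 57075, 55652, 54396, 53292, 52306, 51457, 50722,
    50162, 49786, 49590, 49598, 49718, 50028, 50489, 51141, 51947, 52975, 54165, 52032, 54760,
    57760, 60840, 64000, 67240, 70560] else
  if y = - 7 then [
    123393, 117893, 112569, 107421, 102450, 97659, 93050, 88642, 84422, 80389, 76545, 73704,
    71429, 69097, 66915, 64965, 63158, 61510, 59914, 58359, 57016, 55840, 54816, 53910, 53148,
    52526, 52046, 51750, 51634, 51728, 51928, 52348, 52889, 53651, 54537, 55671, 56941, 54894,
    57760, 60840, 64000, 67240, 70560] else
  if y = - 6 then [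
    127306, 121753, 116373, 111169, 106141, 101290, 96619, 92149, 87862, 83762, 79849, 76692,
    74390, 72205, 69953, 67851, 65981, 64254, 62686, 61212, 59737, 58474, 57378, 56434, 55608,
    54926, 54386, 53986, 53770, 53734, 53912, 54218, 54719, 55369, 56211, 57201, 58423, 59797,
    57854, 60840, 64000, 67240, 70560] else
  if y = - 5 then [
    131230, 125626, 120193, 114933, 109849, 104941, 100210, 95678, 91329, 87162, 83182, 79735,
    77360, 75138, 73052, 70905, 68883, 67093, 65446, 63958, 62562, 61167, 59984, 58968, 58104,
    57358, 56756, 56312, 55990, 55854, 55914, 56172, 56588, 57169, 57921, 58843, 59945, 61247,
    62733, 60894, 64000, 67240, 70560] else
  if y = - 4 then [
    135162, 129510, 124026, 118713, 113573, 108609, 103821, 99229, 94818, 90589, 86542, 82896,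
    80421, 78126, 75984, 73978, 71905, 69963, 68253, 66686, 65278, 63974, 62677, 61574, 60638,
    59854, 59188, 58666, 58302, 58060, 58004, 58174, 58512, 59028, 59689, 60553, 61555, 62769,
    64151, 65745, 64029, 67240, 70560] else
  if y = - 3 then [
    139102, 133402, 127870, 122506, 117313, 112293, 107449, 102800, 98329, 94038, 89929, 86057,
    83546, 81151, 78936, 76874, 74948, 72985, 71123, 69493, 68006, 66678, 65454, 64267, 63244,
    62388, 61684, 61098, 60656, 60372, 60210, 60234, 60502, 60920, 61545, 62289, 63265, 64347,
    65667, 67129, 68833, 67249, 70560] else
  if y = - 2 then [
    143050, 137302, 131722, 126310, 121066, 115993, 111093, 106388, 101860, 97509, 93338, 89358,
    86707, 84276, 81961, 79826, 77844, 75998, 74145, 72363, 70813, 69406, 68158, 67014, 65923,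
    64980, 64204, 63580, 63074, 62712, 62508, 62426, 62530, 62895, 63408, 64113, 64969, 66025,
    67211, 68625, 70181, 72000, 70560] else
  if y = - 1 then [
    147003, 141210, 135582, 130122, 124830, 119706, 114753, 109992, 105408, 101000, 96769,
    92718, 89986, 87437, 85086, 82851, 80796, 78894, 77128, 75369, 73667, 72197, 70870, 69702,
    68638, 67659, 66796, 66100, 65556, 65130, 64848, 64724, 64722, 64906, 65351, 65976, 66761,
    67719, 68855, 70147, 71641, 73313, 75212] else
  if y = 0 then [
    150959, 145123, 139450, 133942, 128602, 123430, 118426, 113612, 108972, 104508, 100220,
    96109, 92998, 90686, 88229, 85958, 83803, 81828, 80006, 78320, 76647, 75051, 73661, 72414,
    71326, 70342, 69475, 68692, 68076, 67612, 67266, 67064, 67020, 67098, 67362, 67887, 68612,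
    69477, 70539, 71755, 73163, 74737, 76525] else
  if y = 1 then [
    150959, 145123, 139450, 133942, 128602, 123430, 118507, 113842, 109393, 105159, 101289,
    98579, 96065, 93678, 91446, 89101, 86910, 84835, 82940, 81198, 79592, 77999, 76515, 75205,
    74038, 73030, 72126, 71346, 70654, 70118, 69734, 69468, 69346, 69382, 69540, 69884, 70489,
    71316, 72261, 73439, 74735, 76259, 77913] else
  if y = 2 then [
    154915, 148999, 143254, 137698, 132321, 127129, 122146, 117405, 112902, 108617, 104589,
    101809, 99179, 96745, 94438, 92286, 90030, 87935, 85947, 84132, 82470, 80944, 79431, 78043,
    76813, 75726, 74798, 73974, 73274, 72682, 72226, 71922, 71736, 71694, 71810, 72048, 72472,
    73157, 74084, 75125, 76383, 77795, 79409] else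
  if y = 3 then [
    158863, 149035, 147114, 141498, 136074, 130853, 125805, 120990, 116406, 112069, 107951,
    105109, 102409, 99859, 97505, 95278, 93196, 91027, 89015, 87121, 85386, 83804, 82355, 80925,
    79635, 78485, 77478, 76630, 75886, 75266, 74766, 74398, 74178, 74066, 74122, 74308, 74636,
    75140, 75905, 76912, 78069, 79407, 80935] else
  if y = 4 then [
    162791, 152931, 147114, 145294, 139806, 134513, 129433, 124597, 119937, 115514, 111345,
    108425, 105677, 103069, 100599, 98325, 96178, 94164, 92075, 90155, 88357, 86702, 85200,
    83815, 82481, 81271, 80228, 79310, 78542, 77878, 77336, 76918, 76630, 76490, 76458, 76592,
    76860, 77300, 77888, 78733, 79820, 81069, 82487] else
  if y = 5 then [
    166703, 156811, 150886, 145294, 143546, 138186, 133029, 128112, 123426, 118986, 114729,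
    111544, 108961, 106303, 103785, 101399, 99205, 97138, 95183, 93181, 91355, 89673, 88098,
    86676, 85335, 84097, 82987, 82024, 81190, 80502, 79918, 79452, 79118, 78910, 78850, 78850,
    79048, 79410, 79948, 80657, 81585, 82752, 84125] else
  if y = 6 then [
    170599, 160675, 152963, 149002, 143546, 141870, 136641, 131644, 126873, 122341, 118062,
    114620, 112068, 109553, 106987, 104549, 102239, 100125, 98138, 96255, 94345, 92595, 90997,
    89502, 88160, 86895, 85737, 84711, 83828, 83096, 82474, 81974, 81576, 81324, 81202, 81172,
    81274, 81560, 82014, 82628, 83456, 84488, 85764] else
  if y = 7 then [
    174479, 164523, 154810, 152778, 147201, 141870, 140266, 135192, 130340, 125718, 121342,
    117575, 115012, 112584, 110153, 107663, 105305, 103119, 101085, 99178, 97335, 95501, 93875,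
    92358, 90974, 89679, 88485, 87417, 86474, 85706, 85050, 84512, 84070, 83760, 83596, 83498,
    83564, 83752, 84080, 84610, 85348, 86300, 87456] else
  if y = 8 then [
    178315, 168331, 158590, 154810, 150906, 145469, 140275, 138728, 133792, 129081, 124609,
    120604, 117923, 115440, 113092, 110761, 108355, 106119, 104059, 102105, 100267, 98423,
    96715, 95180, 93776, 92451, 91213, 90099, 89130, 88294, 87598, 87030, 86564, 86210, 85980,
    85881, 85858, 85924, 86154, 86608, 87264, 88128, 89206] else
  if y = 9 then [
    182095, 172087, 162322, 156490, 154574, 149113, 143818, 138846, 137228, 132428, 127858,
    123589, 120885, 118307, 115904, 113603, 111279, 109099, 106991, 105025, 103164, 101283,
    99567, 97956, 96532, 95205, 93915, 92757, 91754, 90882, 90134, 89510, 89026, 88636, 88370,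
    88220, 88081, 88058, 88252, 88610, 89192, 89976, 90968] else
  if y = 10 then [
    185843, 175811, 166022, 160150, 156602, 152693, 147381, 142297, 137521, 135792, 131129,
    126714, 123818, 121213, 118752, 116391, 114059, 111871, 109827, 107909, 106038, 104133,
    102379, 100766, 99260, 97920, 96621, 95419, 94372, 93458, 92686, 92014, 91476, 91054, 90760,
    90580, 90329, 90233, 90338, 90660, 91146, 91856, 92768] else
  if y = 11 then [
    189559, 179503, 169690, 162410, 158186, 156286, 150913, 145770, 140902, 136299, 134420,
    129898, 126787, 124051, 121586, 119205, 116791, 114595, 112533, 110585, 108770, 106973,
    105181, 103532, 102022, 100604, 99303, 98085, 96994, 96028, 95224, 94532, 93944, 93474,
    93156, 92938, 92613, 92433, 92465, 92698, 93148, 93762, 94600] else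
  if y = 12 then [
    193199, 183123, 173290, 165850, 161761, 158306, 154389, 149237, 144246, 139577, 135289,
    133069, 129826, 126916, 124296, 121944, 119443, 117211, 115125, 113166, 111297, 109465,
    107793, 106258, 104712, 103296, 101937, 100695, 99585, 98574, 97726, 97014, 96398, 95882,
    95504, 95249, 94857, 94633, 94583, 94745, 95108, 95688, 96432] else
  if y = 13 then [
    196799, 186703, 176850, 167470, 165386, 159770, 157881, 152612, 147617, 142849, 138389,
    135319, 132598, 129817, 127041, 124574, 122145, 119793, 117661, 115678, 113755, 111917,
    110222, 108650, 107238, 105936, 104607, 103281, 102145, 101120, 100228, 99466, 98838, 98298,
    97862, 97513, 97089, 96827, 96733, 96813, 97105, 97598, 98308] else
  if y = 14 then [
    200359, 190243, 180370, 171070, 167570, 163269, 159910, 156004, 150946, 146114, 141551,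
    138329, 135425, 132806, 129886, 127226, 124868, 122323, 120166, 118134, 116159, 114315,
    112594, 111002, 109554, 108242, 107035, 105905, 104681, 103634, 102730, 101918, 101250,
    100692, 100240, 99816, 99303, 99009, 98877, 98913, 99123, 99545, 100168] else
  if y = 15 then [
    203767, 193639, 183754, 174114, 170890, 166773, 161227, 159356, 154169, 149334, 144665,
    141321, 138203, 135434, 132637, 129831, 127316, 124869, 122469, 120422, 118377, 116496,
    114760, 113166, 111682, 110346, 109097, 107949, 106946, 106054, 105130, 104306, 103600,
    102996, 102534, 102048, 101468, 101089, 100929, 100931, 101101, 101445, 102001] else
  if y = 16 then [
    207179, 197035, 187134, 177478, 172378, 170233, 164626, 161363, 157444, 152473, 147809,
    144373, 141145, 138189, 135518, 132578, 129884, 127474, 124907, 122698, 120722, 118702,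
    116936, 115316, 113830, 112454, 111165, 110001, 108970, 108074, 107314, 106686, 105978,
    105328, 104828, 104292, 103692, 103244, 102997, 102969, 103103, 103405, 103881] else
  if y = 17 then [
    210479, 200323, 190410, 180742, 175841, 172466, 168021, 162646, 160672, 155598, 150862,
    147184, 144077, 140939, 138118, 135301, 132443, 129894, 127425, 124973, 122878, 120807,
    118978, 117320, 115812, 114408, 113101, 111910, 110854, 109958, 109170, 108530, 108034,
    107622, 107086, 106448, 105836, 105370, 105056, 104943, 105049, 105317, 105753] else
  if y = 18 then [
    213655, 203491, 193570, 183894, 178214, 175546, 171361, 165873, 162742, 158673, 153822,
    149908, 146977, 143733, 140737, 138006, 135038, 132284, 129832, 127235, 124966, 122942,
    120880, 119178, 117614, 116201, 114874, 113662, 112598, 111662, 110878, 110234, 109702,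
    109274, 109006, 108573, 107888, 107412, 107082, 106904, 106927, 107169, 107573] else
  if y = 19 then [
    216767, 206595, 196666, 186982, 181394, 176850, 174645, 169122, 163889, 161732, 156769,
    152511, 149700, 146551, 143383, 140518, 137646, 134747, 132134, 129633, 127133, 124974,
    122869, 120976, 119352, 117892, 116546, 115338, 114254, 113302, 112510, 111838, 111288,
    110862, 110293, 109837, 109541, 109408, 109068, 108874, 108832, 108991, 109369] else
  if y = 20 then [
    219815, 209635, 199698, 190006, 184586, 180189, 176930, 172365, 167014, 163993, 159698,
    155188, 152260, 149385, 146121, 143085, 140300, 137303, 134492, 131976, 129347, 127030,
    124942, 122846, 121080, 119526, 118166, 116922, 115826, 114878, 114046, 113366, 112800,
    112153, 111509, 111037, 110733, 110589, 110608, 110804, 110746, 110840, 111135] else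
  if y = 21 then [
    222719, 212535, 202594, 192898, 185930, 183513, 179758, 175488, 170070, 164991, 162609,
    157777, 154739, 151948, 148819, 145619, 142706, 139783, 136851, 134170, 131607, 129065,
    126854, 124711, 122750, 121058, 119594, 118334, 117222, 116254, 115422, 114730, 114016,
    113201, 112553, 112065, 111749, 111601, 111613, 111788, 112140, 112652, 112884] else
  if y = 22 then [
    225467, 215283, 205342, 195646, 189233, 185970, 180835, 178600, 173121, 167909, 165031,
    160462, 157221, 154284, 151425, 148169, 145093, 142240, 139199, 136344, 133752, 131079,
    128686, 126538, 124396, 122554, 120924, 119542, 118426, 117434, 116606, 115894, 115298,
    114056, 113401, 112913, 112585, 112429, 112441, 112613, 112948, 113460, 114132] else
  [])"

definition hf :: "int \<Rightarrow> int" where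
  "hf n = (if \<bar>n\<bar> \<le> 100 then half_table ! nat \<bar>n\<bar> else 0)"

definition chord_area :: "int \<Rightarrow> int" where
  "chord_area n = area_table ! nat n"

definition cutoff :: "int \<Rightarrow> int" where
  "cutoff k = cutoff_table ! nat k"

text \<open>40 k^2 is the area of a square of side k/50 in the chosen unit. As a bound it is
  vacuous, which suffices for lines so low that no table row is kept.\<close>

definition cap_area :: "int \<Rightarrow> int \<Rightarrow> int" where
  "cap_area y k = (if y < - 44 then 40 * (k * k) else cap_row y ! nat k)"

lemma upto_0_42: "map f [0..42::int] = [f 0, f 1, f 2, f 3, f 4, f 5, f 6, f 7, f 8, f 9, f 10, f 11, f 12, f 13, f 14, f 15, f 16, f 17, f 18, f 19, f 20, f 21, f 22, f 23, f 24, f 25, f 26, f 27, f 28, f 29, f 30, f 31, f 32, f 33, f 34, f 35, f 36, f 37, f 38, f 39, f 40, f 41, f 42]"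
  by (simp add: upto.simps)

lemma upto_0_100: "map f [0..100::int] = [f 0, f 1, f 2, f 3, f 4, f 5, f 6, f 7, f 8, f 9, f 10, f 11, f 12, f 13, f 14, f 15, f 16, f 17, f 18, f 19, f 20, f 21, f 22, f 23, f 24, f 25, f 26, f 27, f 28, f 29, f 30, f 31, f 32, f 33, f 34, f 35, f 36, f 37, f 38, f 39, f 40, f 41, f 42, f 43, f 44, f 45, f 46, f 47, f 48, f 49, f 50, f 51, f 52, f 53, f 54, f 55, f 56, f 57, f 58, f 59, f 60, f 61, f 62, f 63, f 64, f 65, f 66, f 67, f 68, f 69, f 70, f 71, f 72, f 73, f 74, f 75, f 76, f 77, f 78, f 79, f 80, f 81, f 82, f 83, f 84, f 85, f 86, f 87, f 88, f 89, f 90, f 91, f 92, f 93, f 94, f 95, f 96, f 97, f 98, f 99, f 100]"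
  by (simp add: upto.simps)

lemma hf_minus: "hf (- n) = hf n"
  by (simp add: hf_def)

text \<open>Once the index range and the table are unfolded, this equation of lists splits into one
  equation per entry. The same device serves the other tables.\<close>

lemma map_hf: "length half_table = 101 \<Longrightarrow> map hf [0..100] = half_table"
  by (rule nth_equalityI) (auto simp: hf_def)

lemma map_chord_area: "length area_table = 101 \<Longrightarrow> map chord_area [0..100] = area_table"
  by (rule nth_equalityI) (auto simp: chord_area_def)

lemma map_cutoff: "length cutoff_table = 43 \<Longrightarrow> map cutoff [0..42] = cutoff_table"
  by (rule nth_equalityI) (auto simp: cutoff_def)

lemma map_cap_area: "- 44 \<le> y \<Longrightarrow> length (cap_row y) = 43 \<Longrightarrow> map (cap_area y) [0..42] = cap_row y"
  by (rule nth_equalityI) (auto simp: cap_area_def)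

lemma cap_area_low: "y < - 44 \<Longrightarrow> cap_area y k = 40 * (k * k)"
  by (simp add: cap_area_def)

lemmas hf_eqs = map_hf[unfolded upto_0_100 half_table_def, simplified]
lemmas chord_area_eqs = map_chord_area[unfolded upto_0_100 area_table_def, simplified]
lemmas cutoff_eqs = map_cutoff[unfolded upto_0_42 cutoff_table_def, simplified]
lemmas cap_area_eqs =
  map_cap_area[of "- 44", unfolded upto_0_42 cap_row_def, simplified]
  map_cap_area[of "- 43", unfolded upto_0_42 cap_row_def, simplified]
  map_cap_area[of "- 42", unfolded upto_0_42 cap_row_def, simplified]
  map_cap_area[of "- 41", unfolded upto_0_42 cap_row_def, simplified]
  map_cap_area[of "- 40", unfolded upto_0_42 cap_row_def, simplified]
  map_cap_area[of "- 39", unfolded upto_0_42 cap_row_def, simplified]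
  map_cap_area[of "- 38", unfolded upto_0_42 cap_row_def, simplified]
  map_cap_area[of "- 37", unfolded upto_0_42 cap_row_def, simplified]
  map_cap_area[of "- 36", unfolded upto_0_42 cap_row_def, simplified]
  map_cap_area[of "- 35", unfolded upto_0_42 cap_row_def, simplified]
  map_cap_area[of "- 34", unfolded upto_0_42 cap_row_def, simplified]
  map_cap_area[of "- 33", unfolded upto_0_42 cap_row_def, simplified]
  map_cap_area[of "- 32", unfolded upto_0_42 cap_row_def, simplified]
  map_cap_area[of "- 31", unfolded upto_0_42 cap_row_def, simplified]
  map_cap_area[of "- 30", unfolded upto_0_42 cap_row_def, simplified]
  map_cap_area[of "- 29", unfolded upto_0_42 cap_row_def, simplified]
  map_cap_area[of "- 28", unfolded upto_0_42 cap_row_def, simplified]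
  map_cap_area[of "- 27", unfolded upto_0_42 cap_row_def, simplified]
  map_cap_area[of "- 26", unfolded upto_0_42 cap_row_def, simplified]
  map_cap_area[of "- 25", unfolded upto_0_42 cap_row_def, simplified]
  map_cap_area[of "- 24", unfolded upto_0_42 cap_row_def, simplified]
  map_cap_area[of "- 23", unfolded upto_0_42 cap_row_def, simplified]
  map_cap_area[of "- 22", unfolded upto_0_42 cap_row_def, simplified]
  map_cap_area[of "- 21", unfolded upto_0_42 cap_row_def, simplified]
  map_cap_area[of "- 20", unfolded upto_0_42 cap_row_def, simplified]
  map_cap_area[of "- 19", unfolded upto_0_42 cap_row_def, simplified]
  map_cap_area[of "- 18", unfolded upto_0_42 cap_row_def, simplified]
  map_cap_area[of "- 17", unfolded upto_0_42 cap_row_def, simplified]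
  map_cap_area[of "- 16", unfolded upto_0_42 cap_row_def, simplified]
  map_cap_area[of "- 15", unfolded upto_0_42 cap_row_def, simplified]
  map_cap_area[of "- 14", unfolded upto_0_42 cap_row_def, simplified]
  map_cap_area[of "- 13", unfolded upto_0_42 cap_row_def, simplified]
  map_cap_area[of "- 12", unfolded upto_0_42 cap_row_def, simplified]
  map_cap_area[of "- 11", unfolded upto_0_42 cap_row_def, simplified]
  map_cap_area[of "- 10", unfolded upto_0_42 cap_row_def, simplified]
  map_cap_area[of "- 9", unfolded upto_0_42 cap_row_def, simplified]
  map_cap_area[of "- 8", unfolded upto_0_42 cap_row_def, simplified]
  map_cap_area[of "- 7", unfolded upto_0_42 cap_row_def, simplified]
  map_cap_area[of "- 6", unfolded upto_0_42 cap_row_def, simplified]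
  map_cap_area[of "- 5", unfolded upto_0_42 cap_row_def, simplified]
  map_cap_area[of "- 4", unfolded upto_0_42 cap_row_def, simplified]
  map_cap_area[of "- 3", unfolded upto_0_42 cap_row_def, simplified]
  map_cap_area[of "- 2", unfolded upto_0_42 cap_row_def, simplified]
  map_cap_area[of "- 1", unfolded upto_0_42 cap_row_def, simplified]
  map_cap_area[of "0", unfolded upto_0_42 cap_row_def, simplified]
  map_cap_area[of "1", unfolded upto_0_42 cap_row_def, simplified]
  map_cap_area[of "2", unfolded upto_0_42 cap_row_def, simplified]
  map_cap_area[of "3", unfolded upto_0_42 cap_row_def, simplified]
  map_cap_area[of "4", unfolded upto_0_42 cap_row_def, simplified]
  map_cap_area[of "5", unfolded upto_0_42 cap_row_def, simplified]
  map_cap_area[of "6", unfolded upto_0_42 cap_row_def, simplified]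
  map_cap_area[of "7", unfolded upto_0_42 cap_row_def, simplified]
  map_cap_area[of "8", unfolded upto_0_42 cap_row_def, simplified]
  map_cap_area[of "9", unfolded upto_0_42 cap_row_def, simplified]
  map_cap_area[of "10", unfolded upto_0_42 cap_row_def, simplified]
  map_cap_area[of "11", unfolded upto_0_42 cap_row_def, simplified]
  map_cap_area[of "12", unfolded upto_0_42 cap_row_def, simplified]
  map_cap_area[of "13", unfolded upto_0_42 cap_row_def, simplified]
  map_cap_area[of "14", unfolded upto_0_42 cap_row_def, simplified]
  map_cap_area[of "15", unfolded upto_0_42 cap_row_def, simplified]
  map_cap_area[of "16", unfolded upto_0_42 cap_row_def, simplified]
  map_cap_area[of "17", unfolded upto_0_42 cap_row_def, simplified]
  map_cap_area[of "18", unfolded upto_0_42 cap_row_def, simplified]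
  map_cap_area[of "19", unfolded upto_0_42 cap_row_def, simplified]
  map_cap_area[of "20", unfolded upto_0_42 cap_row_def, simplified]
  map_cap_area[of "21", unfolded upto_0_42 cap_row_def, simplified]
  map_cap_area[of "22", unfolded upto_0_42 cap_row_def, simplified]

lemma upto_numeral: "[0..0::int] = [0]" "[0..1::int] = [0, 1]" "[0..numeral n::int] = 0 # 1 # [2..numeral n]"
  by (simp_all add: upto_rec1)

text \<open>One equation per table entry keeps the terms small during the evaluation, while rules
  that pass the tables around as lists would be far too slow.\<close>

lemmas eval_simps = if_True if_False simp_thms rel_simps arith_simps arith_special numeral_One Let_def
  min_def max_def list.pred_inject upto_rec_numeral upto_numeral mult_zero_left mult_zero_right
  mult_1_left mult_1_right add_0_left add_0_right diff_0 diff_0_right mult_minus1_right mult_minus1 minus_zero neg_le_iff_le neg_less_iff_less Num.inc.simps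
  hf_minus hf_eqs chord_area_eqs cutoff_eqs cap_area_low cap_area_eqs

section \<open>Integer tests for table entries and starting configurations\<close>

definition reach_below :: "int \<Rightarrow> int \<Rightarrow> int" where
  "reach_below y d = (let e = y - d in min (hf (2 * y)) (hf (2 * e)))"

text \<open>The units are mixed: \<open>y\<close> counts fiftieths but the side \<open>b\<close>
  hundredths, because boxes of sides may be halved while lines stay on the grid.\<close>

definition reach_above :: "int \<Rightarrow> int \<Rightarrow> int" where
  "reach_above y b = (let c = 2 * y in min (hf c) (hf (c + b)))"

text \<open>A lower bound for \<open>Phi\<close> with b = (k + 1)/50 at height - t/100. The sum
  stops at the cutoff, beyond which chord length minus b would contribute negatively, whereas the
  integrand of \<open>Phi\<close> is truncated at 0.\<close>

definition tail_area :: "int \<Rightarrow> int \<Rightarrow> int" where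
  "tail_area k t = (let m = cutoff k in chord_area m - chord_area t - 20 * (k + 1) * (m - t))"

definition lower_ok :: "int \<Rightarrow> int \<Rightarrow> int \<Rightarrow> bool" where
  "lower_ok y k n \<longleftrightarrow> (let t = 2 * (k + 1) - 2 * y in
     if t \<le> cutoff k then n \<le> 40 * (k * k) + tail_area k t else False)"

definition upper_ok :: "int \<Rightarrow> int \<Rightarrow> int \<Rightarrow> bool" where
  "upper_ok y k n \<longleftrightarrow> (let b = k + 1 in if b \<le> y \<and> 2 * b \<le> cutoff k
     then n \<le> 40 * (k * k) + max 0 (2 * hf (2 * y) - 20 * b) * (2 * (y - b)) + tail_area k (2 * b) else False)"

text \<open>The integer form of \<open>good_row\<close>. The factor \<open>2 * j\<close> converts a
  side of j/50 times a length in thousandths into area units.\<close>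

definition row_ok :: "int \<Rightarrow> int \<Rightarrow> int \<Rightarrow> bool" where
  "row_ok y k n \<longleftrightarrow> (let b = k + 1; z = y - b in if - 50 \<le> z then
     let w = reach_below y b in if 10 * b \<le> w then
     let v = w - 20 * b; m = n - 40 * (k * k) in
       list_all (\<lambda>j. let d = j + 1 in m \<le> 2 * j * max 0 (v + (reach_below y d - 20 * d)) + cap_area z j) [0..k]
     else False else False)"

text \<open>An entry may be justified as vacuous, by the row below it, by the integral bounds, or by
  one step of the recursion. Conditionals replace the connectives here and in the other tests
  because, with \<open>if_weak_cong\<close>, a branch is evaluated only after its condition has been
  decided; the expensive recursion comes last.\<close>

definition entry_ok :: "int \<Rightarrow> int \<Rightarrow> bool" where
  "entry_ok y k \<longleftrightarrow> (let n = cap_area y k in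
     if n \<le> 40 * (k * k) then True else if n \<le> cap_area (y - 1) k then True else
     if (if y \<le> 0 then lower_ok y k n else upper_ok y k n) then True else row_ok y k n)"

definition row_valid :: "int \<Rightarrow> bool" where
  "row_valid y \<longleftrightarrow> list_all (entry_ok y) [0..42]"
definition one_fits :: "int \<Rightarrow> int \<Rightarrow> bool" where
  "one_fits y b \<longleftrightarrow> (if 2 * y + b \<le> 100 then 5 * b \<le> reach_above y b else False)"

definition two_fit :: "int \<Rightarrow> int \<Rightarrow> int \<Rightarrow> bool" where
  "two_fit y b c \<longleftrightarrow> (if one_fits y b then if one_fits y c then 10 * (b + c) \<le> reach_above y b + reach_above y c
     else False else False)"

text \<open>A downward search for a suitable line, where values up to -50 signal failure. Only the
  property tested is ever used; that no higher line would do is never claimed. The start value 22 in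
  the checks is the last row of the table.\<close>

function highest_one :: "int \<Rightarrow> int \<Rightarrow> int" where
  "highest_one y b = (if y \<le> - 50 then y else if one_fits y b then y else highest_one (y - 1) b)"
  by auto
termination by (relation "Wellfounded.measure (\<lambda>(y, b). nat (y + 50))") auto

function highest_two :: "int \<Rightarrow> int \<Rightarrow> int \<Rightarrow> int" where
  "highest_two y b c = (if y \<le> - 50 then y else if two_fit y b c then y else highest_two (y - 1) b c)"
  by auto
termination by (relation "Wellfounded.measure (\<lambda>(y, b, c). nat (y + 50))") auto

declare highest_one.simps [simp del] highest_two.simps [simp del]

text \<open>The first square has side at most b/100; the rest, of area r, goes into a rectangle of height 4/5 and
  width w/1000, where 916 is \<open>hf 40\<close>.\<close>

definition stack_ok :: "int \<Rightarrow> int \<Rightarrow> bool" where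
  "stack_ok b r \<longleftrightarrow> (let w = 916 - 5 * b; u = w + 800 in
     if 0 \<le> w then if 10 * r < w * w then 80 * r < 6400 * w - u * u else False else False)"

text \<open>Here the side of the largest square ranges from a/100 to b/100 and that of the second one
  over the left-open interval from c/100 to d/100, which is part of the bracket k. The bound 160001 exceeds
  8/5 only to make the inequality for the total area strict.\<close>

definition box_ok :: "int \<Rightarrow> int \<Rightarrow> int \<Rightarrow> int \<Rightarrow> int \<Rightarrow> int \<Rightarrow> bool" where
  "box_ok a b y c d k \<longleftrightarrow> (if b \<le> c then True else let n = 160001 - 10 * (a * a); r = n - 10 * (c * c) in
     if r \<le> 0 then True
     else if (if k \<le> 42 then if - 50 < y then n \<le> cap_area y k else False else False) then True
     else if stack_ok b (r - 1) then True
     else if k \<le> 42 then let z = highest_two 22 b d in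
       if - 50 < z then list_all (\<lambda>i. r \<le> cap_area z i) [0..k] else False
     else False)"

text \<open>A box of mesh 1/50 that fails as a whole is cut into four boxes of mesh 1/100. The lines
  \<open>y\<close> and \<open>z\<close> belong to the upper ends \<open>b\<close> and
  \<open>m\<close> of the largest side.\<close>

definition pair_ok :: "int \<Rightarrow> int \<Rightarrow> int \<Rightarrow> int \<Rightarrow> bool" where
  "pair_ok i y z k \<longleftrightarrow> (let a = 2 * i; m = a + 1; b = a + 2; c = 2 * k; n = c + 1; d = c + 2 in
     if box_ok a b y c d k then True
     else if box_ok a m z c n k then if box_ok a m z n d k then
          if box_ok m b y c n k then box_ok m b y n d k else False else False else False)"

definition column_ok :: "int \<Rightarrow> bool" where
  "column_ok i \<longleftrightarrow> (let y = highest_one 22 (2 * i + 2); z = highest_one 22 (2 * i + 1) in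
     list_all (pair_ok i y z) [0..i])"

definition half_disk_ok :: "int \<Rightarrow> bool" where
  "half_disk_ok k \<longleftrightarrow> (let t = 2 * (k + 1) in
     if t \<le> cutoff k then 160001 \<le> 40 * (k * k) + 2 * tail_area k t else False)"

lemmas check_simps = eval_simps reach_below_def reach_above_def tail_area_def lower_ok_def
  upper_ok_def row_ok_def entry_ok_def row_valid_def one_fits_def two_fit_def highest_one.simps highest_two.simps
  stack_ok_def box_ok_def pair_ok_def column_ok_def half_disk_ok_def

lemma hf_checked: "list_all (\<lambda>n. hf n * hf n \<le> 1000000 - 100 * (n * n)) [0..100]"
  by (simp only: check_simps cong: if_weak_cong)

lemma chord_area_checked: "list_all (\<lambda>n. chord_area (n + 1) = chord_area n + (hf n + hf (n + 1))) [0..99]"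
  by (simp only: check_simps cong: if_weak_cong)

lemma cutoff_checked: "list_all (\<lambda>k. cutoff k \<le> 100) [0..42]"
  by (simp only: check_simps cong: if_weak_cong)

section \<open>Soundness of the integer tests\<close>

lemma list_all_upto: "list_all P [a..b] \<Longrightarrow> a \<le> k \<Longrightarrow> k \<le> b \<Longrightarrow> P k"
  by (simp add: list_all_iff)

lemma hf_le_half:
  assumes "\<bar>n\<bar> \<le> 100"
  shows "of_int (hf n) / 1000 \<le> half (of_int n / 100)"
proof -
  have "hf n * hf n \<le> 1000000 - 100 * (n * n)"
    using list_all_upto[OF hf_checked, of "\<bar>n\<bar>"] assms by (auto simp: hf_def)
  then have "real_of_int (hf n * hf n) \<le> real_of_int (1000000 - 100 * (n * n))" by (simp only: of_int_le_iff)
  then have "(of_int (hf n) / 1000)\<^sup>2 \<le> 1 - (of_int n / 100 :: real)\<^sup>2"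
    by (simp add: power2_eq_square field_simps)
  then show "of_int (hf n) / 1000 \<le> half (of_int n / 100)"
    unfolding half_def by (rule real_le_rsqrt)
qed

lemma le_reach: "c \<le> half y \<Longrightarrow> c \<le> half (y - s) \<Longrightarrow> c \<le> reach y s"
  by (cases "\<bar>y\<bar> \<le> \<bar>y - s\<bar>") (simp_all add: reach_def)

lemma reach_below_le:
  assumes "\<bar>y\<bar> \<le> 50" "\<bar>y - d\<bar> \<le> 50"
  shows "of_int (reach_below y d) / 1000 \<le> reach (of_int y / 50) (of_int d / 50)"
proof -
  have "of_int (hf (2 * y)) / 1000 \<le> half (of_int y / 50)"
    using hf_le_half[of "2 * y"] assms by simp
  moreover have "of_int (hf (2 * (y - d))) / 1000 \<le> half (of_int y / 50 - of_int d / 50)"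
    using hf_le_half[of "2 * (y - d)"] assms by (simp add: diff_divide_distrib)
  ultimately show ?thesis by (intro le_reach) (auto simp: reach_below_def Let_def min_def)
qed

lemma reach_above_le:
  assumes "- 50 \<le> y" "0 \<le> b" "2 * y + b \<le> 100"
  shows "of_int (reach_above y b) / 1000 \<le> reach (- (of_int y / 50)) (of_int b / 100)"
proof -
  have "of_int (hf (2 * y)) / 1000 \<le> half (of_int y / 50)"
    using hf_le_half[of "2 * y"] assms by simp
  moreover have "of_int (hf (2 * y + b)) / 1000 \<le> half (- (of_int y / 50) - of_int b / 100)"
    using hf_le_half[of "2 * y + b"] half_minus[of "of_int y / 50 + of_int b / 100"] assms
    by (simp add: add_divide_distrib)
  ultimately show ?thesis by (intro le_reach) (auto simp: reach_above_def Let_def min_def)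
qed

text \<open>This is concavity of \<open>half\<close>, read off from convexity of the disk: the
  segment between two points of the circle stays inside.\<close>

lemma half_above_chord:
  assumes "p < q" "- 1 \<le> p" "q \<le> 1" "p \<le> t" "t \<le> q"
  shows "((q - t) * half p + (t - p) * half q) / (q - p) \<le> half t"
proof -
  define l where "l = (t - p) / (q - p)"
  have l: "0 \<le> l" "l \<le> 1" using assms by (auto simp: l_def)
  have tp: "t - p = l * (q - p)" using assms by (simp add: l_def)
  then have qt: "q - t = (1 - l) * (q - p)" and t: "t = (1 - l) * p + l * q"
    by (simp_all add: algebra_simps)
  have "(q - t) * half p + (t - p) * half q = ((1 - l) * half p + l * half q) * (q - p)"
    unfolding tp qt by (simp add: algebra_simps)
  then have eq: "((q - t) * half p + (t - p) * half q) / (q - p) = (1 - l) * half p + l * half q"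
    using assms by simp
  have "Complex ((1 - l) * half p + l * half q) ((1 - l) * p + l * q) \<in> cball 0 1"
  proof -
    have "Complex (half p) p \<in> cball 0 1" "Complex (half q) q \<in> cball 0 1"
      using half_sq[of p] half_sq[of q] assms by (auto simp: mem_disk simp del: mem_cball mem_cball_0)
    then have "(1 - l) *\<^sub>R Complex (half p) p + l *\<^sub>R Complex (half q) q \<in> cball 0 1"
      using l by (intro convexD[OF convex_cball]) auto
    moreover have "(1 - l) *\<^sub>R Complex (half p) p + l *\<^sub>R Complex (half q) q =
        Complex ((1 - l) * half p + l * half q) ((1 - l) * p + l * q)"
      by (simp add: complex_eq_iff)
    ultimately show ?thesis by simp
  qed
  then have "((1 - l) * half p + l * half q)\<^sup>2 \<le> 1 - t\<^sup>2"
    unfolding mem_disk t by simp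
  then show ?thesis unfolding eq half_def[of t] by (rule real_le_rsqrt)
qed

lemma trapezoid_le_integral:
  fixes f :: "real \<Rightarrow> real"
  assumes "p < q" "f integrable_on {p..q}"
    and "\<And>t. t \<in> {p..q} \<Longrightarrow> ((q - t) * u + (t - p) * v) / (q - p) \<le> f t"
  shows "(q - p) * (u + v) / 2 \<le> integral {p..q} f"
proof -
  define m where "m = (v - u) / (q - p)"
  have v: "v = u + m * (q - p)" using assms(1) by (simp add: m_def)
  have "(q - t) * u + (t - p) * v = ((u - m * p) + m * t) * (q - p)" for t
    unfolding v by (simp add: algebra_simps)
  then have lin: "((q - t) * u + (t - p) * v) / (q - p) = (u - m * p) + m * t" for t
    using assms(1) by simp
  have I: "((\<lambda>t. (u - m * p) + m * t) has_integral ((q - p) * (u - m * p) + m * ((q\<^sup>2 - p\<^sup>2) / 2))) {p..q}"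
    using has_integral_add[OF has_integral_const_real[of "u - m * p" p q]
        has_integral_mult_right[OF ident_has_integral[of p q], of m]] assms(1) by simp
  have eq: "(q - p) * (u - m * p) + m * ((q\<^sup>2 - p\<^sup>2) / 2) = (q - p) * (u + v) / 2"
    unfolding v by (simp add: field_simps power2_eq_square)
  have "(f has_integral integral {p..q} f) {p..q}" using assms(2) by (rule integrable_integral)
  then show ?thesis
    by (rule has_integral_le[OF I[unfolded eq]]) (use assms(3) lin in auto)
qed

text \<open>One cell of width 1/100. By concavity the trapezoid lies below the graph, and rounding
  the half chords down lowers it further; \<open>c / 100\<close> is the side subtracted.\<close>

lemma Phi_cell:
  assumes "0 \<le> n" "n < 100"
  shows "(of_int (hf n + hf (n + 1)) - 10 * c) / 100000 \<le>
    Phi (c / 100) (- (of_int n / 100)) - Phi (c / 100) (- (of_int (n + 1) / 100))"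
proof -
  let ?p = "- (of_int (n + 1) / 100) :: real" and ?q = "- (of_int n / 100) :: real"
  let ?f = "\<lambda>t. max 0 (2 * half t - c / 100)"
  have pq: "?p < ?q" "- 1 \<le> ?p" "?q \<le> 0" using assms by auto
  have "(?q - ?p) * ((2 * half ?p - c / 100) + (2 * half ?q - c / 100)) / 2 \<le> integral {?p..?q} ?f"
  proof (rule trapezoid_le_integral[OF pq(1) Phi_integrable])
    fix t assume t: "t \<in> {?p..?q}"
    have "((?q - t) * (2 * half ?p - c / 100) + (t - ?p) * (2 * half ?q - c / 100)) / (?q - ?p) =
        2 * (((?q - t) * half ?p + (t - ?p) * half ?q) / (?q - ?p)) - c / 100"
      using pq(1) by (simp add: divide_simps) (simp add: algebra_simps)
    also have "\<dots> \<le> 2 * half t - c / 100"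
    proof -
      have "((?q - t) * half ?p + (t - ?p) * half ?q) / (?q - ?p) \<le> half t"
        by (rule half_above_chord) (use pq t in auto)
      then show ?thesis by linarith
    qed
    finally show "((?q - t) * (2 * half ?p - c / 100) + (t - ?p) * (2 * half ?q - c / 100)) / (?q - ?p) \<le> ?f t"
      by simp
  qed
  moreover have "integral {?p..?q} ?f = Phi (c / 100) ?q - Phi (c / 100) ?p"
    unfolding Phi_def
    using Henstock_Kurzweil_Integration.integral_combine[of "- 1" ?p ?q ?f] pq Phi_integrable by simp
  moreover have "of_int (hf n) / 1000 \<le> half ?q" "of_int (hf (n + 1)) / 1000 \<le> half ?p"
    using hf_le_half[of n] hf_le_half[of "n + 1"] assms by simp_all
  moreover have "?q - ?p = 1 / 100" by (simp add: field_simps)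
  ultimately show ?thesis by (simp add: field_simps)
qed

text \<open>The cells telescope, and the value of \<open>Phi\<close> at the outer end is dropped as
  nonnegative.\<close>

lemma Phi_ge_chord_area:
  assumes "0 \<le> t" "t \<le> m" "m \<le> 100"
  shows "(of_int (chord_area m - chord_area t) - 10 * c * of_int (m - t)) / 100000 \<le> Phi (c / 100) (- (of_int t / 100))"
proof -
  have "(of_int (chord_area m - chord_area t) - 10 * c * of_int (m - t)) / 100000 \<le>
      Phi (c / 100) (- (of_int t / 100)) - Phi (c / 100) (- (of_int m / 100))"
    using assms(2,3)
  proof (induction m rule: int_ge_induct)
    case (step m)
    have "chord_area (m + 1) = chord_area m + (hf m + hf (m + 1))"
      using list_all_upto[OF chord_area_checked, of m] step assms(1) by simp
    then show ?case using step Phi_cell[of m c] assms(1) by (simp add: field_simps)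
  qed simp
  then show ?thesis using Phi_nonneg[of "c / 100" "- (of_int m / 100)"] by linarith
qed

lemma tail_area_le_Phi:
  assumes "0 \<le> k" "k \<le> 42" "0 \<le> t" "t \<le> cutoff k"
  shows "of_int (tail_area k t) / 100000 \<le> Phi (of_int (k + 1) / 50) (- (of_int t / 100))"
proof -
  have "cutoff k \<le> 100" using list_all_upto[OF cutoff_checked] assms by simp
  moreover have "2 * real_of_int (k + 1) / 100 = of_int (k + 1) / 50" by simp
  ultimately show ?thesis
    using Phi_ge_chord_area[of t "cutoff k" "2 * of_int (k + 1)"] assms
    by (simp only: tail_area_def Let_def of_int_diff of_int_mult of_int_add of_int_1 of_int_numeral) simp
qed

definition valid :: "int \<Rightarrow> int \<Rightarrow> int \<Rightarrow> bool" where
  "valid y k n \<longleftrightarrow> good (of_int y / 50) (of_int k / 50) (of_int (k + 1) / 50) (of_int n / 100000)"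

lemma valid_mono: "valid y k n \<Longrightarrow> y \<le> y' \<Longrightarrow> n' \<le> n \<Longrightarrow> valid y' k n'"
  unfolding valid_def by (erule good_mono) (auto simp: divide_right_mono)

lemma valid_trivial:
  assumes "0 \<le> k" "n \<le> 40 * (k * k)"
  shows "valid y k n"
proof -
  have "real_of_int n \<le> of_int (40 * (k * k))" using assms(2) by (simp only: of_int_le_iff)
  then show ?thesis
    unfolding valid_def using assms(1)
    by (intro good_trivial) (simp_all add: power2_eq_square field_simps)
qed

lemma valid_lower:
  assumes "0 \<le> k" "k \<le> 42" "y \<le> 0" "lower_ok y k n"
  shows "valid y k n"
proof -
  define t where "t = 2 * (k + 1) - 2 * y"
  have t: "0 \<le> t" "t \<le> cutoff k" "n \<le> 40 * (k * k) + tail_area k t"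
    using assms by (auto simp: lower_ok_def t_def Let_def split: if_splits)
  have "real_of_int n \<le> of_int (40 * (k * k) + tail_area k t)" using t(3) by (simp only: of_int_le_iff)
  moreover have "of_int (tail_area k t) / 100000 \<le> Phi (of_int (k + 1) / 50) (- (of_int t / 100))"
    using tail_area_le_Phi assms t by blast
  moreover have "- (of_int t / 100 :: real) = of_int y / 50 - of_int (k + 1) / 50"
    by (simp add: t_def field_simps)
  ultimately show ?thesis
    unfolding valid_def using assms
    by (intro good_lower) (simp_all add: power2_eq_square field_simps)
qed

lemma valid_upper:
  assumes "0 \<le> k" "k \<le> 42" "0 < y" "y \<le> 50" "upper_ok y k n"
  shows "valid y k n"
proof -
  define b where "b = k + 1"
  have b: "b \<le> y" "2 * b \<le> cutoff k" "0 \<le> b"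
    and n: "n \<le> 40 * (k * k) + max 0 (2 * hf (2 * y) - 20 * b) * (2 * (y - b)) + tail_area k (2 * b)"
    using assms by (auto simp: upper_ok_def b_def Let_def split: if_splits)
  have "of_int (tail_area k (2 * b)) / 100000 \<le> Phi (of_int b / 50) (- (of_int (2 * b) / 100))"
    using tail_area_le_Phi[of k "2 * b"] assms b by (simp add: b_def)
  then have tail: "of_int (tail_area k (2 * b)) / 100000 \<le> Phi (of_int b / 50) (- (of_int b / 50))" by simp
  have "of_int (hf (2 * y)) / 1000 \<le> half (of_int y / 50)"
    using hf_le_half[of "2 * y"] assms by simp
  then have "of_int (max 0 (2 * hf (2 * y) - 20 * b)) / 1000 \<le> max 0 (2 * half (of_int y / 50) - of_int b / 50)"
    by (auto simp: max_def)
  moreover have "0 \<le> of_int (2 * (y - b)) / (100 :: real)" using b by simp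
  ultimately have "of_int (max 0 (2 * hf (2 * y) - 20 * b)) / 1000 * (of_int (2 * (y - b)) / 100) \<le>
      max 0 (2 * half (of_int y / 50) - of_int b / 50) * (of_int (2 * (y - b)) / 100)"
    by (rule mult_right_mono)
  also have "of_int (2 * (y - b)) / 100 = of_int y / 50 - (of_int b / 50 :: real)" by (simp add: field_simps)
  finally have "of_int (max 0 (2 * hf (2 * y) - 20 * b)) / 1000 * (of_int y / 50 - of_int b / 50) \<le>
      max 0 (2 * half (of_int y / 50) - of_int b / 50) * (of_int y / 50 - of_int b / 50)" .
  moreover have "real_of_int n \<le> of_int (40 * (k * k) + max 0 (2 * hf (2 * y) - 20 * b) * (2 * (y - b)) + tail_area k (2 * b))"
    using n by (simp only: of_int_le_iff)
  then have "of_int n / 100000 \<le> (of_int k / 50)\<^sup>2 +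
      of_int (max 0 (2 * hf (2 * y) - 20 * b)) / 1000 * (of_int y / 50 - of_int b / 50) +
      of_int (tail_area k (2 * b)) / (100000 :: real)"
    by (simp add: power2_eq_square field_simps)
  ultimately have "of_int n / 100000 \<le> (of_int k / 50)\<^sup>2 +
      max 0 (2 * half (of_int y / 50) - of_int b / 50) * (of_int y / 50 - of_int b / 50) +
      Phi (of_int b / 50) (- (of_int b / 50))"
    using tail by linarith
  then show ?thesis
    unfolding valid_def b_def[symmetric] using assms by (intro good_upper) auto
qed

text \<open>Brackets are open on the left, so a side at most (k + 1)/50 falls into a bracket with
  index at most \<open>k\<close>. This keeps the recursion within the indices tested.\<close>

lemma bracket:
  fixes c :: real
  assumes "0 < c" "0 < N"
  obtains j :: int where "0 \<le> j" "of_int j / N < c" "c \<le> of_int (j + 1) / N"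
proof
  have "0 < c * N" using assms by simp
  then show "0 \<le> \<lceil>c * N\<rceil> - 1" by simp
  have "of_int (\<lceil>c * N\<rceil> - 1) < c * N" "c * N \<le> of_int (\<lceil>c * N\<rceil> - 1 + 1)" by linarith+
  then show "of_int (\<lceil>c * N\<rceil> - 1) / N < c" "c \<le> of_int (\<lceil>c * N\<rceil> - 1 + 1) / N"
    using assms by (simp_all add: field_simps)
qed

lemma valid_row:
  assumes k: "0 \<le> k" and y: "y \<le> 50" and ok: "row_ok y k n"
    and IH: "\<And>j. 0 \<le> j \<Longrightarrow> j \<le> k \<Longrightarrow> valid (y - (k + 1)) j (cap_area (y - (k + 1)) j)"
  shows "valid y k n"
proof -
  define b where "b = k + 1"
  define v where "v = reach_below y b - 20 * b"
  have z: "- 50 \<le> y - b" and fit: "10 * b \<le> reach_below y b"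
    and child: "list_all (\<lambda>j. n - 40 * (k * k) \<le> 2 * j * max 0 (v + (reach_below y (j + 1) - 20 * (j + 1))) + cap_area (y - b) j) [0..k]"
    using ok by (auto simp: row_ok_def b_def v_def Let_def split: if_splits)
  have rb: "of_int (reach_below y b) / 1000 \<le> reach (of_int y / 50) (of_int b / 50)"
    using z y k by (intro reach_below_le) (auto simp: b_def)
  show ?thesis
    unfolding valid_def b_def[symmetric]
  proof (rule good_row)
    show "0 \<le> of_int k / (50 :: real)" "of_int y / (50 :: real) \<le> 1" using k y by simp_all
    have "- 50 \<le> real_of_int (y - b)" using z by linarith
    then show "- 1 \<le> of_int y / 50 - of_int b / (50 :: real)" by (simp add: field_simps)
    have "real_of_int (10 * b) \<le> of_int (reach_below y b)" using fit by (simp only: of_int_le_iff)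
    then show "of_int b / 50 \<le> 2 * reach (of_int y / 50) (of_int b / 50)" using rb by simp
    fix c :: real assume c: "0 < c" "c \<le> of_int b / 50"
    obtain j :: int where j: "0 \<le> j" "of_int j / 50 < c" "c \<le> of_int (j + 1) / 50"
      using bracket[OF c(1), of 50] by auto
    have "real_of_int j < of_int b" using j(2) c(2) by simp
    then have jk: "j \<le> k" by (simp add: b_def)
    define d where "d = j + 1"
    have rd: "of_int (reach_below y d) / 1000 \<le> reach (of_int y / 50) (of_int d / 50)"
      using z y j(1) jk by (intro reach_below_le) (auto simp: b_def d_def)
    let ?x = "reach (of_int y / 50) (of_int b / 50) + reach (of_int y / 50) (of_int d / 50) - of_int b / 50 - of_int d / 50"
    have "of_int (v + (reach_below y d - 20 * d)) / 1000 \<le> ?x"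
      using rb rd by (simp add: v_def field_simps)
    then have "of_int (max 0 (v + (reach_below y d - 20 * d))) / 1000 \<le> max 0 ?x"
      by (simp add: max_def)
    then have "of_int j / 50 * (of_int (max 0 (v + (reach_below y d - 20 * d))) / 1000) \<le> of_int j / 50 * max 0 ?x"
      using j(1) by (intro mult_left_mono) auto
    moreover have "n - 40 * (k * k) \<le> 2 * j * max 0 (v + (reach_below y d - 20 * d)) + cap_area (y - b) j"
      using list_all_upto[OF child j(1) jk] by (simp add: d_def)
    then have "real_of_int (n - 40 * (k * k)) \<le> of_int (2 * j * max 0 (v + (reach_below y d - 20 * d)) + cap_area (y - b) j)"
      by (simp only: of_int_le_iff)
    then have "of_int n / 100000 - (of_int k / 50)\<^sup>2 \<le>
        of_int j / 50 * (of_int (max 0 (v + (reach_below y d - 20 * d))) / 1000) + of_int (cap_area (y - b) j) / (100000 :: real)"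
      by (simp add: power2_eq_square field_simps)
    ultimately have le: "of_int n / 100000 - (of_int k / 50)\<^sup>2 - of_int j / 50 * max 0 ?x \<le> of_int (cap_area (y - b) j) / 100000"
      by linarith
    have "good (of_int y / 50 - of_int b / 50) (of_int j / 50) (of_int d / 50) (of_int (cap_area (y - b) j) / 100000)"
      using IH[OF j(1) jk] unfolding valid_def d_def b_def[symmetric] by (simp add: diff_divide_distrib)
    then have "good (of_int y / 50 - of_int b / 50) (of_int j / 50) (of_int d / 50)
        (of_int n / 100000 - (of_int k / 50)\<^sup>2 - of_int j / 50 * max 0 ?x)"
      by (rule good_mono[OF _ order_refl le])
    then show "\<exists>c1 c2. 0 \<le> c1 \<and> c1 \<le> c \<and> c \<le> c2 \<and>
        good (of_int y / 50 - of_int b / 50) c1 c2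
          (of_int n / 100000 - (of_int k / 50)\<^sup>2 -
           c1 * max 0 (reach (of_int y / 50) (of_int b / 50) + reach (of_int y / 50) c2 - of_int b / 50 - c2))"
      using j by (intro exI[of _ "of_int j / 50"] exI[of _ "of_int d / 50"]) (auto simp: d_def)
  qed
qed

lemma valid_cap_area:
  assumes "list_all row_valid [- 44..22]"
  shows "y \<le> 22 \<Longrightarrow> 0 \<le> k \<Longrightarrow> k \<le> 42 \<Longrightarrow> valid y k (cap_area y k)"
\<comment> \<open>The offset 45 makes the measure positive from row -44 on, so every smaller line is
  available to the induction hypothesis there; lower lines need none.\<close>
proof (induction "nat (y + 45)" arbitrary: y k rule: less_induct)
  case less
  show ?case
  proof (cases "y < - 44")
    case True
    then show ?thesis using less.prems by (intro valid_trivial) (auto simp: cap_area_low)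
  next
    case False
    have IH: "valid z j (cap_area z j)" if "z < y" "0 \<le> j" "j \<le> 42" for z j
      using less.hyps[of z j] that False less.prems by simp
    have "list_all (entry_ok y) [0..42]"
      using list_all_upto[OF assms, of y] False less.prems by (simp add: row_valid_def)
    then have "entry_ok y k" using less.prems(2,3) by (rule list_all_upto)
    then consider "cap_area y k \<le> 40 * (k * k)" | "cap_area y k \<le> cap_area (y - 1) k"
      | "y \<le> 0" "lower_ok y k (cap_area y k)" | "0 < y" "upper_ok y k (cap_area y k)"
      | "row_ok y k (cap_area y k)"
      by (auto simp: entry_ok_def Let_def split: if_splits)
    then show ?thesis
    proof cases
      case 1 then show ?thesis using valid_trivial[of k] less.prems by simp
    next
      case 2 then show ?thesis using valid_mono[OF IH[of "y - 1" k], of y] less.prems by simp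
    next
      case 3 then show ?thesis using valid_lower[of k y] less.prems by simp
    next
      case 4 then show ?thesis using valid_upper[of k y] less.prems by simp
    next
      case 5
      show ?thesis
        by (rule valid_row[OF _ _ 5]) (use less.prems in \<open>auto intro!: IH\<close>)
    qed
  qed
qed

lemma highest_one_cases: "highest_one y b \<le> - 50 \<or> one_fits (highest_one y b) b"
proof (induction y b rule: highest_one.induct)
  case (1 y b)
  then show ?case using highest_one.simps[of y b] by (cases "y \<le> - 50 \<or> one_fits y b") auto
qed

lemma highest_one_le: "highest_one y b \<le> y"
proof (induction y b rule: highest_one.induct)
  case (1 y b)
  then show ?case using highest_one.simps[of y b] by (cases "y \<le> - 50 \<or> one_fits y b") auto
qed

lemma highest_two_cases: "highest_two y b c \<le> - 50 \<or> two_fit (highest_two y b c) b c"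
proof (induction y b c rule: highest_two.induct)
  case (1 y b c)
  then show ?case using highest_two.simps[of y b c] by (cases "y \<le> - 50 \<or> two_fit y b c") auto
qed

lemma highest_two_le: "highest_two y b c \<le> y"
proof (induction y b c rule: highest_two.induct)
  case (1 y b c)
  then show ?case using highest_two.simps[of y b c] by (cases "y \<le> - 50 \<or> two_fit y b c") auto
qed

lemma one_fits_real:
  assumes "one_fits y b" "- 50 \<le> y" "0 \<le> b"
  shows "of_int y / 50 + of_int b / 100 \<le> (1 :: real)"
    "of_int b / 100 \<le> 2 * (of_int (reach_above y b) / 1000 :: real)"
    "of_int (reach_above y b) / 1000 \<le> reach (- (of_int y / 50)) (of_int b / 100)"
proof -
  have f: "2 * y + b \<le> 100" "5 * b \<le> reach_above y b" using assms by (auto simp: one_fits_def split: if_splits)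
  have "real_of_int (2 * y + b) \<le> of_int 100" using f(1) by (simp only: of_int_le_iff)
  then show "of_int y / 50 + of_int b / 100 \<le> (1 :: real)" by simp
  have "real_of_int (5 * b) \<le> of_int (reach_above y b)" using f(2) by (simp only: of_int_le_iff)
  then show "of_int b / 100 \<le> 2 * (of_int (reach_above y b) / 1000 :: real)" by simp
  show "of_int (reach_above y b) / 1000 \<le> reach (- (of_int y / 50)) (of_int b / 100)"
    using reach_above_le assms f by blast
qed

lemma sq_ge_of_int:
  fixes s :: real
  assumes "of_int a / 100 \<le> s" "0 \<le> a"
  shows "of_int (10 * (a * a)) / 100000 \<le> s\<^sup>2"
proof -
  have "(of_int a / 100)\<^sup>2 \<le> s\<^sup>2" using assms by (intro power_mono) auto
  then show ?thesis by (simp add: power2_eq_square)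
qed

text \<open>A box passes if it is empty, or if one of three configurations works: the largest square
  on a line, the two largest stacked, or both on a line. The table ends at index 42, so a second
  square of a higher index can only be stacked.\<close>

lemma packs_box:
  assumes rows: "list_all row_valid [- 44..22]" and ok: "box_ok a b y c d k"
    and y: "y \<le> 22" "y \<le> - 50 \<or> one_fits y b"
    and xs: "desc (s # t # xs)" "total_area (s # t # xs) \<le> 8 / 5"
    and s: "of_int a / 100 \<le> s" "s \<le> of_int b / 100" and t: "of_int c / 100 < t" "t \<le> of_int d / 100"
    and ac: "0 \<le> a" "0 \<le> c" and k: "0 \<le> k" "2 * k \<le> c" "d \<le> 2 * k + 2"
  shows "packs (s # t # xs) (cball 0 1)"
proof -
  define n where "n = 160001 - 10 * (a * a)"
  define r where "r = n - 10 * (c * c)"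
  have pos: "0 < t" "t \<le> s" "desc (t # xs)" using xs(1) by (auto simp: desc_Cons)
  have b0: "0 \<le> b" "0 \<le> d" using s t ac pos by (auto intro: ccontr)
  have s2: "of_int (10 * (a * a)) / 100000 \<le> s\<^sup>2" using s ac by (intro sq_ge_of_int) auto
  have t2: "of_int (10 * (c * c)) / 100000 \<le> t\<^sup>2" using t ac by (intro sq_ge_of_int) auto
  have n: "total_area (t # xs) < of_int n / 100000" using xs(2) s2 by (simp add: n_def field_simps)
  have r: "total_area xs \<le> of_int (r - 1) / 100000" using xs(2) s2 t2 by (simp add: r_def n_def field_simps)
  \<comment> \<open>Such a box is empty, since t <= s. The left-open interval for \<open>t\<close>
    makes this work even for b = c.\<close>
  have "\<not> b \<le> c"
  proof
    assume "b \<le> c"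
    then have "real_of_int b \<le> of_int c" by simp
    then show False using s t pos by linarith
  qed
  moreover have "\<not> r \<le> 0"
  proof
    assume "r \<le> 0"
    then have "of_int (r - 1) < (0 :: real)" by simp
    then show False using r total_area_nonneg[of xs] by (simp add: field_simps)
  qed
  moreover have kt: "of_int k / 50 \<le> t" "t \<le> of_int (k + 1) / 50"
  proof -
    have "real_of_int (2 * k) \<le> of_int c" "real_of_int d \<le> of_int (2 * k + 2)" using k by (simp_all only: of_int_le_iff)
    then show "of_int k / 50 \<le> t" "t \<le> of_int (k + 1) / 50" using t by simp_all
  qed
  ultimately consider "k \<le> 42" "- 50 < y" "n \<le> cap_area y k" | "stack_ok b (r - 1)"
    | "k \<le> 42" "- 50 < highest_two 22 b d" "list_all (\<lambda>i. r \<le> cap_area (highest_two 22 b d) i) [0..k]"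
    using ok by (auto simp: box_ok_def n_def r_def Let_def split: if_splits)
  then show ?thesis
  proof cases
    case 1
    have "valid y k n" using valid_cap_area[OF rows y(1) k(1) 1(1)] 1(3) by (rule valid_mono[OF _ order_refl])
    then have "packs (t # xs) (cap (of_int y / 50))"
      unfolding valid_def good_def using pos kt n by blast
    then show ?thesis
      using xs s 1 y one_fits_real[of y b] b0 by (intro packs_one_on_top[where b = "of_int b / 100"]) auto
  next
    case 2
    define w where "w = 916 - 5 * b"
    have w: "0 \<le> w" "10 * (r - 1) < w * w" "80 * (r - 1) < 6400 * w - (w + 800) * (w + 800)"
      using 2 by (auto simp: stack_ok_def w_def Let_def split: if_splits)
    have "hf 40 = 916" by (simp only: check_simps)
    then have "of_int 916 / 1000 \<le> half (2 / 5)" using hf_le_half[of 40] by simp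
    then have "of_int w / 1000 + of_int b / 100 / 2 \<le> half (2 / 5)" by (simp add: w_def field_simps)
    moreover have "real_of_int (10 * (r - 1)) < of_int (w * w)" using w(2) by (simp only: of_int_less_iff)
    then have "of_int (r - 1) / 100000 < (of_int w / 1000 :: real)\<^sup>2"
      by (simp add: power2_eq_square field_simps)
    moreover have "real_of_int (80 * (r - 1)) < of_int (6400 * w - (w + 800) * (w + 800))"
      using w(3) by (simp only: of_int_less_iff)
    then have "of_int (r - 1) / 100000 < 4 / 5 * (of_int w / 1000) - (of_int w / 1000 + 4 / 5 :: real)\<^sup>2 / 8"
      by (simp add: power2_eq_square field_simps)
    ultimately show ?thesis
      using xs s w(1) r by (intro packs_two_stacked[where b = "of_int b / 100" and w = "of_int w / 1000"]) auto
  next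
    case 3
    define z where "z = highest_two 22 b d"
    have z: "z \<le> 22" "- 50 < z" "two_fit z b d"
      using highest_two_le[of 22 b d] highest_two_cases[of 22 b d] 3(2) by (auto simp: z_def)
    have fb: "one_fits z b" "one_fits z d" "10 * (b + d) \<le> reach_above z b + reach_above z d"
      using z(3) by (auto simp: two_fit_def split: if_splits)
    have "packs xs (cap (of_int z / 50))"
    proof (cases xs)
      case (Cons u us)
      have u: "desc (u # us)" "0 < u" "u \<le> t" using xs(1) Cons by (auto simp: desc_Cons)
      obtain i :: int where i: "0 \<le> i" "of_int i / 50 < u" "u \<le> of_int (i + 1) / 50"
        using bracket[OF u(2), of 50] by auto
      have "real_of_int i < of_int (k + 1)" using i u kt by simp
      then have ik: "i \<le> k" by simp
      have "r \<le> cap_area z i" using list_all_upto[OF 3(3) i(1) ik] by (simp add: z_def)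
      moreover have "valid z i (cap_area z i)" using valid_cap_area[OF rows z(1) i(1)] ik 3(1) by simp
      ultimately have "valid z i r" using valid_mono[of z i "cap_area z i" z r] by simp
      then have "good (of_int z / 50) (of_int i / 50) (of_int (i + 1) / 50) (of_int r / 100000)"
        by (simp only: valid_def)
      moreover have "total_area (u # us) < of_int r / 100000" using r Cons by (simp add: field_simps)
      ultimately show ?thesis using u i unfolding good_def Cons by (meson less_imp_le)
    qed simp
    moreover have "real_of_int (10 * (b + d)) \<le> of_int (reach_above z b + reach_above z d)" using fb(3) by (simp only: of_int_le_iff)
    then have "of_int b / 100 + of_int d / 100 \<le> of_int (reach_above z b) / 1000 + (of_int (reach_above z d) / 1000 :: real)"
      by (simp add: field_simps)
    ultimately show ?thesis
      using xs s t z(2) one_fits_real[OF fb(1)] one_fits_real[OF fb(2)] b0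
      by (intro packs_two_on_top[where b = "of_int b / 100" and c = "of_int d / 100" and y = "of_int z / 50"]) auto
  qed
qed

section \<open>Checking the bounds\<close>

lemma list_all_upto_join:
  assumes "list_all P [a..b]" "list_all P [c..d]" "c = b + 1"
  shows "list_all P [a..d]"
  unfolding list_all_iff
proof
  fix x assume "x \<in> set [a..d]"
  then show "P x" using assms by (cases "x \<le> b") (auto simp: list_all_iff)
qed

text \<open>Carries the unrolling of \<open>[- 11..5]\<close> across \<open>- 1\<close>, which
  simplification writes without a numeral.\<close>

lemma upto_minus_one: "[- 1..numeral n::int] = - 1 # [0..numeral n]"
  by (simp add: upto_rec1)

lemma rows_checked: "list_all row_valid [- 44..22]"
proof -
  have "list_all row_valid [- 44..- 12]"
    by (simp only: check_simps cong: if_weak_cong)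
  moreover have "list_all row_valid [- 11..5]"
    by (simp only: check_simps upto_minus_one cong: if_weak_cong)
  moreover have "list_all row_valid [6..22]"
    by (simp only: check_simps cong: if_weak_cong)
  ultimately show ?thesis
    by (intro list_all_upto_join[of _ "- 44" 5 6 22] list_all_upto_join[of _ "- 44" "- 12" "- 11" 5]) simp_all
qed

lemma columns_checked: "list_all column_ok [15..63]"
proof -
  have "list_all column_ok [15..39]"
    by (simp only: check_simps cong: if_weak_cong)
  moreover have "list_all column_ok [40..63]"
    by (simp only: check_simps cong: if_weak_cong)
  ultimately show ?thesis by (rule list_all_upto_join) simp
qed

lemma half_disk_checked: "list_all half_disk_ok [0..14]"
  by (simp only: check_simps cong: if_weak_cong)

text \<open>Index 14 ends at the side 15/50 = 3/10.\<close>

lemma packs_small: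
  assumes k: "0 \<le> k" "k \<le> 14" and xs: "desc (s # xs)" "total_area (s # xs) \<le> 8 / 5"
    and s: "of_int k / 50 < s" "s \<le> of_int (k + 1) / 50"
  shows "packs (s # xs) (cball 0 1)"
proof -
  define t where "t = 2 * (k + 1)"
  have t: "0 \<le> t" "t \<le> cutoff k" and le: "160001 \<le> 40 * (k * k) + 2 * tail_area k t"
    using list_all_upto[OF half_disk_checked k] k by (auto simp: half_disk_ok_def t_def Let_def split: if_splits)
  have "of_int (tail_area k t) / 100000 \<le> Phi (of_int (k + 1) / 50) (- (of_int t / 100))"
    using tail_area_le_Phi k t by simp
  moreover have "of_int t / 100 = (of_int (k + 1) / 50 :: real)" by (simp add: t_def)
  ultimately have "of_int (tail_area k t) / 100000 \<le> Phi (of_int (k + 1) / 50) (- (of_int (k + 1) / 50))"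
    by simp
  moreover have "of_int (160001) \<le> real_of_int (40 * (k * k) + 2 * tail_area k t)" using le by (simp only: of_int_le_iff)
  then have "160001 / 100000 \<le> (of_int k / 50)\<^sup>2 + 2 * (of_int (tail_area k t) / (100000 :: real))"
    by (simp add: power2_eq_square field_simps)
  moreover have "(of_int k / 50)\<^sup>2 \<le> s\<^sup>2" using s k by (intro power_mono) auto
  ultimately have "total_area (s # xs) < s\<^sup>2 + 2 * Phi (of_int (k + 1) / 50) (- (of_int (k + 1) / 50))"
    using xs(2) by linarith
  then show ?thesis by (rule packs_two_halves[OF xs(1) s(2)])
qed

lemma packs_large:
  assumes i: "15 \<le> i" "i \<le> 63" and xs: "desc (s # t # xs)" "total_area (s # t # xs) \<le> 8 / 5"
    and s: "of_int i / 50 < s" "s \<le> of_int (i + 1) / 50"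
  shows "packs (s # t # xs) (cball 0 1)"
proof -
  define y where "y = highest_one 22 (2 * i + 2)"
  define z where "z = highest_one 22 (2 * i + 1)"
  have yz: "y \<le> 22" "y \<le> - 50 \<or> one_fits y (2 * i + 2)" "z \<le> 22" "z \<le> - 50 \<or> one_fits z (2 * i + 1)"
    by (simp_all only: y_def z_def highest_one_le highest_one_cases)
  have t0: "0 < t" "t \<le> s" using xs(1) by (auto simp: desc_Cons)
  obtain k :: int where k: "0 \<le> k" "of_int k / 50 < t" "t \<le> of_int (k + 1) / 50"
    using bracket[OF t0(1), of 50] by auto
  have "real_of_int k < of_int (i + 1)" using k t0 s by simp
  then have ki: "k \<le> i" by simp
  have pair: "pair_ok i y z k"
  proof -
    have "list_all (pair_ok i y z) [0..i]"
      using list_all_upto[OF columns_checked i] by (simp add: column_ok_def y_def z_def Let_def)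
    then show ?thesis using k(1) ki by (rule list_all_upto)
  qed
  have pack: "packs (s # t # xs) (cball 0 1)"
    if "box_ok a b v c d k" "v \<le> 22" "v \<le> - 50 \<or> one_fits v b"
      "of_int a / 100 \<le> s" "s \<le> of_int b / 100" "of_int c / 100 < t" "t \<le> of_int d / 100"
      "0 \<le> a" "2 * k \<le> c" "d \<le> 2 * k + 2" for a b c d v
    using packs_box[OF rows_checked that(1-3) xs that(4-8)] that k(1) by simp
  show ?thesis
  proof (cases "box_ok (2 * i) (2 * i + 2) y (2 * k) (2 * k + 2) k")
    case True
    then show ?thesis by (rule pack) (use yz s k i in auto)
  next
    case False
    then have boxes: "box_ok (2 * i) (2 * i + 1) z (2 * k) (2 * k + 1) k"
      "box_ok (2 * i) (2 * i + 1) z (2 * k + 1) (2 * k + 2) k"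
      "box_ok (2 * i + 1) (2 * i + 2) y (2 * k) (2 * k + 1) k"
      "box_ok (2 * i + 1) (2 * i + 2) y (2 * k + 1) (2 * k + 2) k"
      using pair by (auto simp: pair_ok_def Let_def split: if_splits)
    consider "s \<le> of_int (2 * i + 1) / 100" "t \<le> of_int (2 * k + 1) / 100"
      | "s \<le> of_int (2 * i + 1) / 100" "of_int (2 * k + 1) / 100 < t"
      | "of_int (2 * i + 1) / 100 \<le> s" "t \<le> of_int (2 * k + 1) / 100"
      | "of_int (2 * i + 1) / 100 \<le> s" "of_int (2 * k + 1) / 100 < t"
      by linarith
    then show ?thesis
    proof cases
      case 1 show ?thesis by (rule pack[OF boxes(1)]) (use 1 yz s k i in auto)
    next
      case 2 show ?thesis by (rule pack[OF boxes(2)]) (use 2 yz s k i in auto)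
    next
      case 3 show ?thesis by (rule pack[OF boxes(3)]) (use 3 yz s k i in auto)
    next
      case 4 show ?thesis by (rule pack[OF boxes(4)]) (use 4 yz s k i in auto)
    qed
  qed
qed

lemma packs_unit_disk:
  assumes "desc xs" "total_area xs \<le> 8 / 5"
  shows "packs xs (cball 0 1)"
proof (cases xs)
  case (Cons s ys)
  have s: "0 < s" "s\<^sup>2 \<le> 8 / 5" using assms Cons total_area_nonneg[of ys] by (auto simp: desc_Cons)
  obtain i :: int where i: "0 \<le> i" "of_int i / 50 < s" "s \<le> of_int (i + 1) / 50"
    using bracket[OF s(1), of 50] by auto
  \<comment> \<open>1.28 = 64/50 is the first grid point above sqrt (8/5), so index 63 is the last
    one to check.\<close>
  have "s\<^sup>2 \<le> (128 / 100)\<^sup>2" using s(2) by (simp add: power2_eq_square)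
  then have "s \<le> 128 / 100" by (rule power2_le_imp_le) simp
  then have "real_of_int i < 64" using i(2) by simp
  then have i63: "i \<le> 63" by simp
  show ?thesis
  proof (cases "i \<le> 14")
    case True
    then show ?thesis using packs_small[of i s ys] assms i Cons by simp
  next
    case False
    show ?thesis
    proof (cases ys)
      case Nil
      \<comment> \<open>A single square has no second side to bracket and is placed
        directly.\<close>
      have "square (- s / 2, half (s / 2) - s, s) \<subseteq> cball 0 1"
        using square_touching_top[of s] s by auto
      then show ?thesis using packs_single Cons Nil by simp
    next
      case (Cons t us)
      then show ?thesis using packs_large[of i s t us] assms i i63 False \<open>xs = s # ys\<close> by simp
    qed
  qed
qed simp

section \<open>Optimality\<close>

lemma placed_square_image:
  "placed_square c \<theta> s = (\<lambda>z. c + cis \<theta> * z) ` cbox (Complex (- s / 2) (- s / 2)) (Complex (s / 2) (s / 2))"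
proof (rule set_eqI)
  fix w
  show "w \<in> placed_square c \<theta> s \<longleftrightarrow>
      w \<in> (\<lambda>z. c + cis \<theta> * z) ` cbox (Complex (- s / 2) (- s / 2)) (Complex (s / 2) (s / 2))"
  proof
    assume "w \<in> placed_square c \<theta> s"
    then obtain x y where "w = c + cis \<theta> * Complex x y" "\<bar>x\<bar> \<le> s / 2" "\<bar>y\<bar> \<le> s / 2"
      unfolding placed_square_def by blast
    then show "w \<in> (\<lambda>z. c + cis \<theta> * z) ` cbox (Complex (- s / 2) (- s / 2)) (Complex (s / 2) (s / 2))"
      by (intro image_eqI[of _ _ "Complex x y"]) (auto simp: in_cbox_complex_iff)
  next
    assume "w \<in> (\<lambda>z. c + cis \<theta> * z) ` cbox (Complex (- s / 2) (- s / 2)) (Complex (s / 2) (s / 2))"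
    then obtain z where "w = c + cis \<theta> * z" "z \<in> cbox (Complex (- s / 2) (- s / 2)) (Complex (s / 2) (s / 2))"
      by blast
    then have "w = c + cis \<theta> * Complex (Re z) (Im z) \<and> \<bar>Re z\<bar> \<le> s / 2 \<and> \<bar>Im z\<bar> \<le> s / 2"
      by (auto simp: in_cbox_complex_iff)
    then show "w \<in> placed_square c \<theta> s" unfolding placed_square_def by blast
  qed
qed

lemma convex_placed_square: "convex (placed_square c \<theta> s)"
proof -
  have "linear (\<lambda>z. cis \<theta> * z)"
    by (simp add: bounded_linear.linear bounded_linear_mult_right)
  then have "convex ((\<lambda>z. c + z) ` (\<lambda>z. cis \<theta> * z) ` cbox (Complex (- s / 2) (- s / 2)) (Complex (s / 2) (s / 2)))"
    by (intro convex_translation convex_linear_image) auto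
  then show ?thesis by (simp add: placed_square_image image_image)
qed

lemma smaller_square_in_interior:
  assumes "r < s"
  shows "placed_square c \<theta> r \<subseteq> interior (placed_square c \<theta> s)"
proof
  fix w assume "w \<in> placed_square c \<theta> r"
  then obtain x y where w: "w = c + cis \<theta> * Complex x y" "\<bar>x\<bar> \<le> r / 2" "\<bar>y\<bar> \<le> r / 2"
    unfolding placed_square_def by blast
  have "v \<in> placed_square c \<theta> s" if v: "dist w v < (s - r) / 2" for v
  proof -
    define z where "z = cis (- \<theta>) * (v - w)"
    have "cmod z < (s - r) / 2" using v by (simp add: z_def norm_mult dist_norm norm_minus_commute)
    then have "\<bar>Re z\<bar> < (s - r) / 2" "\<bar>Im z\<bar> < (s - r) / 2"
      using abs_Re_le_cmod[of z] abs_Im_le_cmod[of z] by linarith+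
    then have le: "\<bar>x + Re z\<bar> \<le> s / 2" "\<bar>y + Im z\<bar> \<le> s / 2"
      using w(2,3) abs_triangle_ineq[of x "Re z"] abs_triangle_ineq[of y "Im z"] by argo+
    have "cis \<theta> * z = v - w" by (simp add: z_def mult.assoc[symmetric] cis_mult)
    then have "v = c + cis \<theta> * (Complex x y + z)" using w(1) by (simp add: distrib_left)
    also have "Complex x y + z = Complex (x + Re z) (y + Im z)" by (simp add: complex_eq_iff)
    finally show ?thesis using le unfolding placed_square_def by blast
  qed
  then show "w \<in> interior (placed_square c \<theta> s)"
    unfolding mem_interior using assms by (intro exI[of _ "(s - r) / 2"]) auto
qed

text \<open>In the coordinates of the square, with centre \<open>p\<close> and half side
  \<open>h\<close>, the half plane through the origin keeps the origin out of the interior, so one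
  coordinate of \<open>p\<close> is at least \<open>h\<close> in absolute value. The corner farthest
  from the origin then has squared norm at least (2h)^2 + h^2 = 5 h^2, which must not exceed
  1.\<close>

lemma square_in_half_disk:
  assumes "placed_square c \<theta> s \<subseteq> cball 0 1" "\<forall>x\<in>placed_square c \<theta> s. 0 \<le> n \<bullet> x" "n \<noteq> 0" "0 \<le> s"
  shows "s\<^sup>2 \<le> 4 / 5"
proof -
  define p where "p = cis (- \<theta>) * c"
  define m where "m = cis (- \<theta>) * n"
  define h where "h = s / 2"
  have h: "0 \<le> h" using assms by (simp add: h_def)
  have c: "c = cis \<theta> * p" by (simp add: p_def mult.assoc[symmetric] cis_mult)
  have n: "n = cis \<theta> * m" by (simp add: m_def mult.assoc[symmetric] cis_mult)
  have rot: "(cis \<theta> * u) \<bullet> (cis \<theta> * v) = u \<bullet> v" for u v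
  proof -
    have "(cis \<theta> * u) \<bullet> (cis \<theta> * v) = ((cos \<theta>)\<^sup>2 + (sin \<theta>)\<^sup>2) * (u \<bullet> v)"
      unfolding inner_complex_def by (simp add: power2_eq_square algebra_simps del: sin_cos_squared_add sin_cos_squared_add2 sin_cos_squared_add3)
    then show ?thesis by simp
  qed
  have corner: "cmod (p + Complex x y) \<le> 1 \<and> 0 \<le> m \<bullet> (p + Complex x y)" if "\<bar>x\<bar> \<le> h" "\<bar>y\<bar> \<le> h" for x y
  proof -
    have "c + cis \<theta> * Complex x y \<in> placed_square c \<theta> s"
      using that unfolding placed_square_def h_def by blast
    moreover have "c + cis \<theta> * Complex x y = cis \<theta> * (p + Complex x y)" by (simp add: c distrib_left)
    ultimately have "cis \<theta> * (p + Complex x y) \<in> cball 0 1" "0 \<le> n \<bullet> (cis \<theta> * (p + Complex x y))"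
      using assms(1,2) by auto
    then show ?thesis unfolding n rot by (simp add: norm_mult)
  qed
  \<comment> \<open>\<open>(x, y)\<close> leads to the corner farthest from the origin, and
    \<open>(x', y')\<close> to the one lowest in direction \<open>m\<close>.\<close>
  define x where "x = (if Re p < 0 then - h else h)"
  define y where "y = (if Im p < 0 then - h else h)"
  define x' where "x' = (if Re m < 0 then h else - h)"
  define y' where "y' = (if Im m < 0 then h else - h)"
  have "cmod (p + Complex x y) \<le> 1" using corner[of x y] h by (auto simp: x_def y_def)
  then have "(Re p + x)\<^sup>2 + (Im p + y)\<^sup>2 \<le> 1" by (simp add: cmod_def)
  moreover have "(Re p + x)\<^sup>2 = (\<bar>Re p\<bar> + h)\<^sup>2" "(Im p + y)\<^sup>2 = (\<bar>Im p\<bar> + h)\<^sup>2"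
    by (auto simp: x_def y_def power2_eq_square algebra_simps)
  ultimately have disk: "(\<bar>Re p\<bar> + h)\<^sup>2 + (\<bar>Im p\<bar> + h)\<^sup>2 \<le> 1" by simp
  have "0 \<le> m \<bullet> (p + Complex x' y')" using corner[of x' y'] h by (auto simp: x'_def y'_def)
  moreover have "Re m * x' = - \<bar>Re m\<bar> * h" "Im m * y' = - \<bar>Im m\<bar> * h" by (auto simp: x'_def y'_def)
  ultimately have "\<bar>Re m\<bar> * h + \<bar>Im m\<bar> * h \<le> Re m * Re p + Im m * Im p"
    by (simp add: inner_complex_def distrib_left)
  moreover have "Re m * Re p \<le> \<bar>Re m\<bar> * \<bar>Re p\<bar>" "Im m * Im p \<le> \<bar>Im m\<bar> * \<bar>Im p\<bar>"
    by (metis abs_ge_self abs_mult)+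
  ultimately have half: "\<bar>Re m\<bar> * (h - \<bar>Re p\<bar>) + \<bar>Im m\<bar> * (h - \<bar>Im p\<bar>) \<le> 0"
    by (simp add: algebra_simps)
  have "h \<le> \<bar>Re p\<bar> \<or> h \<le> \<bar>Im p\<bar>"
  proof (rule ccontr)
    assume *: "\<not> (h \<le> \<bar>Re p\<bar> \<or> h \<le> \<bar>Im p\<bar>)"
    then have "0 \<le> \<bar>Re m\<bar> * (h - \<bar>Re p\<bar>)" "0 \<le> \<bar>Im m\<bar> * (h - \<bar>Im p\<bar>)"
      by (auto intro!: mult_nonneg_nonneg)
    then have "\<bar>Re m\<bar> * (h - \<bar>Re p\<bar>) = 0" "\<bar>Im m\<bar> * (h - \<bar>Im p\<bar>) = 0"
      using half by linarith+
    then have "m = 0" using * by (simp add: complex_eq_iff)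
    then show False using assms(3) n by simp
  qed
  moreover have "(2 * h)\<^sup>2 + h\<^sup>2 \<le> (\<bar>a\<bar> + h)\<^sup>2 + (\<bar>b\<bar> + h)\<^sup>2" if "h \<le> \<bar>a\<bar>" for a b :: real
    using that h by (intro add_mono power_mono) auto
  ultimately have "(2 * h)\<^sup>2 + h\<^sup>2 \<le> (\<bar>Re p\<bar> + h)\<^sup>2 + (\<bar>Im p\<bar> + h)\<^sup>2"
    by (metis add.commute)
  then show ?thesis using disk by (simp add: h_def power2_eq_square)
qed

text \<open>The placed squares may touch, but the separation theorem is applied to disjoint sets.
  Both are therefore shrunk to a side \<open>r\<close> still above sqrt (4/5), which puts them into
  the disjoint interiors.\<close>

lemma two_equal_squares_not_packable:
  assumes "4 / 5 < s\<^sup>2" "0 < s"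
  shows "\<not> packs_into [s, s] (cball 0 1)"
proof
  assume "packs_into [s, s] (cball 0 1)"
  then obtain c \<theta> where *: "\<forall>i<2. placed_square (c i) (\<theta> i) ([s, s] ! i) \<subseteq> cball 0 1"
    "\<forall>i<2. \<forall>j<2. i \<noteq> j \<longrightarrow> interior (placed_square (c i) (\<theta> i) ([s, s] ! i)) \<inter>
        interior (placed_square (c j) (\<theta> j) ([s, s] ! j)) = {}"
    unfolding packs_into_def by (auto simp: numeral_2_eq_2)
  define Q where "Q i = placed_square (c i) (\<theta> i)" for i :: nat
  have in_disk: "Q 0 s \<subseteq> cball 0 1" "Q 1 s \<subseteq> cball 0 1"
    using *(1)[rule_format, of 0] *(1)[rule_format, of 1] by (auto simp: Q_def)
  have disj: "interior (Q 0 s) \<inter> interior (Q 1 s) = {}"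
    using *(2)[rule_format, of 0 1] by (simp add: Q_def)
  have "sqrt (4 / 5) < s" using assms by (simp add: real_sqrt_less_iff real_less_rsqrt real_less_lsqrt)
  then obtain r where r: "sqrt (4 / 5) < r" "r < s" using dense by blast
  have r0: "0 < r" using r(1) real_sqrt_gt_zero[of "4 / 5"] by linarith
  have "(sqrt (4 / 5))\<^sup>2 < r\<^sup>2" using r(1) by (intro power_strict_mono) auto
  then have r2: "4 / 5 < r\<^sup>2" by simp
  have int: "Q i r \<subseteq> interior (Q i s)" for i
    unfolding Q_def by (rule smaller_square_in_interior[OF r(2)])
  have sub: "Q 0 r \<subseteq> cball 0 1" "Q 1 r \<subseteq> cball 0 1"
    using int interior_subset in_disk by blast+
  have ne: "Q i r \<noteq> {}" for i
  proof -
    have "c i + cis (\<theta> i) * Complex 0 0 \<in> Q i r"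
      unfolding Q_def placed_square_def using r0 by force
    then show ?thesis by blast
  qed
  have "Q 0 r \<inter> Q 1 r = {}" using int[of 0] int[of 1] disj by blast
  moreover have "convex (Q i r)" for i unfolding Q_def by (rule convex_placed_square)
  ultimately have "\<exists>a b. a \<noteq> 0 \<and> (\<forall>x\<in>Q 0 r. a \<bullet> x \<le> b) \<and> (\<forall>x\<in>Q 1 r. b \<le> a \<bullet> x)"
    using ne by (intro separating_hyperplane_sets)
  then obtain a b where ab: "a \<noteq> 0" "\<forall>x\<in>Q 0 r. a \<bullet> x \<le> b" "\<forall>x\<in>Q 1 r. b \<le> a \<bullet> x" by blast
  have "r\<^sup>2 \<le> 4 / 5"
  \<comment> \<open>The separating line need not pass through the centre. The square on the side
    away from the centre lies in a half disk, and the sign of \<open>b\<close> tells which one it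
    is.\<close>
  proof (cases "0 \<le> b")
    case True
    then have "\<forall>x\<in>Q 1 r. 0 \<le> a \<bullet> x" using ab(3) by force
    then show ?thesis using sub(2) ab(1) r0 unfolding Q_def by (intro square_in_half_disk) auto
  next
    case False
    then have "\<forall>x\<in>Q 0 r. 0 \<le> (- a) \<bullet> x" using ab(2) by force
    then show ?thesis using sub(1) ab(1) r0 unfolding Q_def by (intro square_in_half_disk[of _ _ _ "- a"]) auto
  qed
  then show False using r2 by simp
qed

lemma total_area_mset: "mset xs = mset ys \<Longrightarrow> total_area xs = total_area ys"
  unfolding total_area_def by (metis mset_map sum_mset_sum_list)

theorem theorem1:
  shows "(\<forall>ss :: real list. (\<forall>s \<in> set ss. s > 0) \<and> total_area ss \<le> 8 / 5
            \<longrightarrow> packs_into ss (cball 0 1))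
       \<and> (\<forall>A :: real. A > 8 / 5 \<longrightarrow>
            (\<exists>ss :: real list. (\<forall>s \<in> set ss. s > 0) \<and> total_area ss = A
               \<and> \<not> packs_into ss (cball 0 1)))"
proof (intro conjI allI impI)
  fix ss :: "real list" assume ss: "(\<forall>s \<in> set ss. s > 0) \<and> total_area ss \<le> 8 / 5"
  have "desc (rev (sort ss))"
    using ss by (simp add: desc_def sorted_wrt_rev)
  moreover have "total_area (rev (sort ss)) \<le> 8 / 5"
    using ss total_area_mset[of "rev (sort ss)" ss] by simp
  ultimately have "packs (rev (sort ss)) (cball 0 1)" by (rule packs_unit_disk)
  then have "packs ss (cball 0 1)" by (rule packs_mset) simp
  then show "packs_into ss (cball 0 1)" by (rule packs_imp_packs_into)
next
  fix A :: real assume A: "A > 8 / 5"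
  define s where "s = sqrt (A / 2)"
  have s: "s\<^sup>2 = A / 2" "0 < s" using A by (simp_all add: s_def)
  then have "\<not> packs_into [s, s] (cball 0 1)" using A by (intro two_equal_squares_not_packable) auto
  then show "\<exists>ss :: real list. (\<forall>s \<in> set ss. s > 0) \<and> total_area ss = A \<and> \<not> packs_into ss (cball 0 1)"
    using s by (intro exI[of _ "[s, s]"]) (simp add: total_area_def)
qed

end
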